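(* For $32\le n\le 70$, the value of $L(n,6,6,2)$ is as follows: $L(32)=7$, $L(33)=7$, $L(34)=8$, $L(35)=9$, $L(36)=9$, $L(37)=10$, $L(38)=11$, $L(39)=11$, $L(40)=12$, $L(41)=13$, $L(42)=13$, $L(43)=14$, $L(44)=15$, $L(45)=15$, $L(46)=16$, $L(47)=17$, $L(48)=18$, $L(49)=19$, $L(50)=19$, $L(51)=20$, $L(52)=21$, $L(53)=22$, $L(54)=23$, $L(55)=23$, $L(56)=24$, $L(57)=25$, $L(58)=26$, $L(59)=27$, $L(60)=27$, $L(61)=28$, $L(62)=29$, $L(63)=30$, $L(64)=31$, $L(65)=31$, $L(66)=32$, $L(67)=34$, $L(68)=34$, $L(69)=35$, $L(70)=35$, where $L(n)$ abbreviates $L(n,6,6,2)$.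
   Context: A hypergraph is a pair $H=(X,\mathcal{B})$ with $X$ a finite set of vertices and $\mathcal{B}$ a set of subsets of $X$ (blocks); it is $k$-uniform if every block has exactly $k$ elements. For integers $n\ge k\ge t\ge 2$ and $p$, an $(n,k,p,t;j)$-lottery design is a $k$-uniform hypergraph $(X,\mathcal{B})$ with $|X|=n$ and $|\mathcal{B}|=j$ such that for every $D\subseteq X$ with $|D|=p$ there is $B\in\mathcal{B}$ with $|B\cap D|\ge t$. $L(n,k,p,t)$ denotes the minimum $j$ for which an $(n,k,p,t;j)$-lottery design exists. *)

theory Defs
  imports Main
begin

definition hypergraph :: "'a set \<Rightarrow> 'a set set \<Rightarrow> bool" where
  "hypergraph X \<B> \<longleftrightarrow> finite X \<and> (\<forall>B\<in>\<B>. B \<subseteq> X)"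

definition uniform :: "nat \<Rightarrow> 'a set set \<Rightarrow> bool" where
  "uniform k \<B> \<longleftrightarrow> (\<forall>B\<in>\<B>. card B = k)"

definition lottery_design ::
    "nat \<Rightarrow> nat \<Rightarrow> nat \<Rightarrow> nat \<Rightarrow> nat \<Rightarrow> 'a set \<Rightarrow> 'a set set \<Rightarrow> bool" where
  "lottery_design n k p t j X \<B> \<longleftrightarrow>
     2 \<le> t \<and> t \<le> k \<and> k \<le> n \<and>
     hypergraph X \<B> \<and> uniform k \<B> \<and> card X = n \<and> card \<B> = j \<and>
     (\<forall>D. D \<subseteq> X \<and> card D = p \<longrightarrow> (\<exists>B\<in>\<B>. t \<le> card (B \<inter> D)))"

text \<open>Vertices are taken to be natural numbers. This is no restriction, since every finite
  vertex set can be relabelled by naturals (\<open>lottery_design_relabel\<close>). The set of admissible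
  \<open>j\<close> is nonempty whenever \<open>2 \<le> t \<le> min k p\<close> and \<open>k \<le> n\<close> (\<open>lottery_design_exists\<close>); otherwise
  the value of \<open>lottery_number\<close> is unspecified.\<close>

definition lottery_number :: "nat \<Rightarrow> nat \<Rightarrow> nat \<Rightarrow> nat \<Rightarrow> nat" where
  "lottery_number n k p t =
     (LEAST j. \<exists>(X :: nat set) \<B>. lottery_design n k p t j X \<B>)"

lemma lottery_design_relabel:
  fixes X :: "'a set"
  assumes "lottery_design n k p t j X \<B>"
  shows "\<exists>(Y :: nat set) \<C>. lottery_design n k p t j Y \<C>"
proof -
  have fin: "finite X" and sub: "\<And>B. B \<in> \<B> \<Longrightarrow> B \<subseteq> X"
    using assms by (auto simp: lottery_design_def hypergraph_def)
  obtain f :: "'a \<Rightarrow> nat" where inj: "inj_on f X"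
    using finite_imp_inj_to_nat_seg[OF fin] by blast
  have cf: "card (f ` S) = card S" if "S \<subseteq> X" for S
    using inj that by (meson card_image inj_on_subset)
  have injB: "inj_on ((`) f) \<B>"
    using inj sub by (intro inj_onI) (metis inj_on_image_eq_iff)
  have "\<exists>C\<in>(`) f ` \<B>. t \<le> card (C \<inter> D)" if D: "D \<subseteq> f ` X" "card D = p" for D
  proof -
    obtain E where E: "E \<subseteq> X" "D = f ` E"
      using D(1) by (meson subset_imageE)
    have "card E = p"
      using cf[OF E(1)] D(2) E(2) by simp
    with assms E(1) obtain B where B: "B \<in> \<B>" "t \<le> card (B \<inter> E)"
      by (auto simp: lottery_design_def)
    have "f ` B \<inter> D = f ` (B \<inter> E)"
      using inj_on_image_Int[OF inj sub[OF B(1)] E(1)] E(2) by simp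
    moreover have "card (f ` (B \<inter> E)) = card (B \<inter> E)"
      using E(1) by (intro cf) auto
    ultimately show ?thesis
      using B by (metis imageI)
  qed
  then have "lottery_design n k p t j (f ` X) ((`) f ` \<B>)"
    using assms fin sub cf card_image[OF injB]
    by (auto simp: lottery_design_def hypergraph_def uniform_def)
  then show ?thesis by blast
qed

lemma lottery_design_exists:
  assumes "2 \<le> t" "t \<le> k" "k \<le> n" "t \<le> p"
  shows "\<exists>j (X :: nat set) \<B>. lottery_design n k p t j X \<B>"
proof -
  define X where "X = {..<n}"
  define \<B> where "\<B> = {B. B \<subseteq> X \<and> card B = k}"
  have fin: "finite X" and cX: "card X = n"
    by (simp_all add: X_def)
  have "\<exists>B\<in>\<B>. t \<le> card (B \<inter> D)" if D: "D \<subseteq> X" "card D = p" for D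
  proof -
    obtain T where T: "T \<subseteq> D" "card T = t"
      using obtain_subset_with_card_n assms(4) D(2) by metis
    then obtain B where B: "T \<subseteq> B" "B \<subseteq> X" "card B = k"
      using exists_subset_between[of T k X] D(1) assms fin cX by auto
    have "card T \<le> card (B \<inter> D)"
      using T B fin by (intro card_mono) (auto intro: finite_subset)
    with T B show ?thesis
      by (auto simp: \<B>_def)
  qed
  then have "lottery_design n k p t (card \<B>) X \<B>"
    using assms fin cX
    by (auto simp: lottery_design_def hypergraph_def uniform_def \<B>_def)
  then show ?thesis by blast
qed

end

theory Submission
  imports Defs
begin

text \<open>
  Join two points of a design when some block contains both. The design property for \<open>t = 2\<close> and
  \<open>p = 6\<close> says that no six points are pairwise non-adjacent, so a union of coverings of five
  disjoint point sets is a design. This yields all upper bounds.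

  For the lower bounds let \<open>r(v)\<close> be the number of blocks through \<open>v\<close>. The sum of all \<open>r(v)\<close> is six
  times the number of blocks, so it suffices to bound the total of \<open>3 - r(v)\<close> from above. Deleting the
  neighbourhoods of a maximal independent set of points with \<open>r(v) \<le> 1\<close> leaves only points with
  \<open>r(v) \<ge> 2\<close>. The points with \<open>r(v) = 2\<close> are the edges of a multigraph on the blocks, and independent
  sets of such points are its matchings. A maximum matching of size \<open>s\<close> bounds the number of these points
  against the number of points covered by its blocks. The uncovered points all have \<open>r(v) \<ge> 3\<close> and
  contain at most \<open>5 - s\<close> pairwise non-adjacent points, and any such region with more than \<open>14 (5 - s)\<close>
  points has large total \<open>r(v) - 3\<close>: a point with \<open>r(v) = 3\<close> has at most 15 neighbours, and cliques of
  points with nearly 15 distinct neighbours are small, as in Fisher's inequality. The few extremal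
  configurations that pass this count are stars of the multigraph; exchanging an edge of the star
  shows that the blocks at its leaves would share too many points.
\<close>

section \<open>Degrees and neighbourhoods\<close>

text \<open>One block on 6 points, three blocks on 9 points and seven blocks on 14 points can give
  every point degree 1, 2 and 3 respectively; this fixes the cutoff 3 and the size 14. With the
  deficit d, the total of 3 - r(v), the weighted count 5 d + 9 m is 126 both for m = 9, d = 9 and
  for m = 14, d = 0. The obstacle is that local counts overshoot. The closed neighbourhood of a
  point of degree 3 may have 16 points instead of 14, and excess degree must pay for that. A
  matching edge whose outer edges form a star may have 11 points in its two blocks and deficit 6,
  which gives 30 + 99 = 129; exchange arguments are needed to remove this surplus of 3. The bound
  proved is 5 d + 9 n <= 635 instead of 630, and this is all the slack that rounding permits: with
  636, 30 blocks would not be excluded for 64 points. For 67 points both general bounds stop one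
  block short, hence the separate treatment.\<close>

locale blocks =
  fixes F :: "'a set set"
  assumes finF: "finite F"
    and finB: "B \<in> F \<Longrightarrow> finite B"
    and cardB: "B \<in> F \<Longrightarrow> card B \<le> 6"
begin

definition deg :: "'a \<Rightarrow> nat" where
  "deg v = card {B \<in> F. v \<in> B}"

definition codeg :: "'a \<Rightarrow> 'a \<Rightarrow> nat" where
  "codeg u v = card {B \<in> F. u \<in> B \<and> v \<in> B}"

definition adj :: "'a \<Rightarrow> 'a \<Rightarrow> bool" where
  "adj u v \<longleftrightarrow> (\<exists>B\<in>F. u \<in> B \<and> v \<in> B)"

text \<open>The \<open>insert\<close> matters for points of degree 0, which must still be deleted
  together with their closed neighbourhood.\<close>

definition nb :: "'a \<Rightarrow> 'a set" where
  "nb v = insert v (\<Union>{B \<in> F. v \<in> B})"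

definition indep :: "'a set \<Rightarrow> bool" where
  "indep I \<longleftrightarrow> (\<forall>u\<in>I. \<forall>v\<in>I. u \<noteq> v \<longrightarrow> \<not> adj u v)"

definition clique :: "'a set \<Rightarrow> bool" where
  "clique K \<longleftrightarrow> (\<forall>u\<in>K. \<forall>v\<in>K. u \<noteq> v \<longrightarrow> adj u v)"

definition alpha_le :: "'a set \<Rightarrow> nat \<Rightarrow> bool" where
  "alpha_le Y b \<longleftrightarrow> finite Y \<and> (\<forall>I. I \<subseteq> Y \<longrightarrow> indep I \<longrightarrow> card I \<le> b)"

text \<open>The subtraction is truncated: points of degree less than 3 contribute 0.\<close>

definition exc :: "'a set \<Rightarrow> nat" where
  "exc Y = (\<Sum>v\<in>Y. deg v - 3)"

lemma adj_sym: "adj u v \<longleftrightarrow> adj v u"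
  by (auto simp: adj_def)

lemma in_nb: "u \<in> nb v \<longleftrightarrow> u = v \<or> adj v u"
  by (auto simp: nb_def adj_def)

lemma nb_self [simp]: "v \<in> nb v"
  by (simp add: in_nb)

lemma in_nb_sym: "u \<in> nb v \<longleftrightarrow> v \<in> nb u"
  using adj_sym[of u v] by (auto simp: in_nb)

lemma finite_nb [simp]: "finite (nb v)"
  using finF finB by (auto simp: nb_def)

lemma fin_sub [simp]: "finite {B \<in> F. P B}"
  using finF by simp

lemma block_sub_nb: "B \<in> F \<Longrightarrow> v \<in> B \<Longrightarrow> B \<subseteq> nb v"
  by (auto simp: nb_def)

lemma alpha_finite: "alpha_le Y b \<Longrightarrow> finite Y"
  by (simp add: alpha_le_def)

lemma alpha_le_card: "alpha_le Y b \<Longrightarrow> I \<subseteq> Y \<Longrightarrow> indep I \<Longrightarrow> card I \<le> b"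
  by (simp add: alpha_le_def)

lemma alpha_le_0: "alpha_le Y 0 \<Longrightarrow> Y = {}"
proof (rule ccontr)
  assume a: "alpha_le Y 0" "Y \<noteq> {}"
  then obtain v where "v \<in> Y" by blast
  then show False
    using alpha_le_card[OF a(1), of "{v}"] by (simp add: indep_def)
qed

lemma alpha_le_1_clique: "alpha_le Y 1 \<Longrightarrow> clique Y"
  unfolding clique_def
proof (intro ballI impI, rule ccontr)
  fix u v assume a: "alpha_le Y 1" "u \<in> Y" "v \<in> Y" "u \<noteq> v" "\<not> adj u v"
  then have "indep {u, v}" using adj_sym[of u v] by (auto simp: indep_def)
  then show False
    using alpha_le_card[OF a(1), of "{u,v}"] a by simp
qed

lemma indep_Un:
  assumes "indep I" "indep J" "J \<inter> (\<Union>x\<in>I. nb x) = {}"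
  shows "indep (I \<union> J)"
proof -
  have *: "\<not> adj x y \<and> \<not> adj y x" if "x \<in> I" "y \<in> J" for x y
    using assms(3) that in_nb[of y x] adj_sym[of x y] by blast
  show ?thesis
    using assms(1,2) * unfolding indep_def by blast
qed

lemma indep_singleton [simp]: "indep {v}"
  by (simp add: indep_def)

lemma indep_insert: "indep I \<Longrightarrow> v \<notin> (\<Union>x\<in>I. nb x) \<Longrightarrow> indep (insert v I)"
  using indep_Un[of I "{v}"] by simp

lemma alpha_le_remove:
  assumes "alpha_le Y b" "S \<subseteq> Y" "indep S"
  shows "alpha_le (Y - (\<Union>x\<in>S. nb x)) (b - card S)" and "card S \<le> b"
proof -
  have fin: "finite Y" using assms by (simp add: alpha_le_def)
  show "card S \<le> b" using assms by (simp add: alpha_le_def)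
  show "alpha_le (Y - (\<Union>x\<in>S. nb x)) (b - card S)"
    unfolding alpha_le_def
  proof (intro conjI allI impI)
    show "finite (Y - (\<Union>x\<in>S. nb x))" using fin by simp
    fix I assume I: "I \<subseteq> Y - (\<Union>x\<in>S. nb x)" "indep I"
    have "indep (S \<union> I)" using indep_Un[OF assms(3) I(2)] I(1) by blast
    moreover have "S \<inter> I = {}"
      using I(1) nb_self by blast
    moreover have "finite S" "finite I"
      using fin I(1) assms(2) by (auto intro: finite_subset)
    ultimately have "card S + card I \<le> b"
      using alpha_le_card[OF assms(1), of "S \<union> I"] I(1) assms(2)
      by (auto simp: card_Un_disjoint)
    then show "card I \<le> b - card S" by simp
  qed
qed

lemma alpha_le_remove1:
  assumes "alpha_le Y (Suc b)" "v \<in> Y"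
  shows "alpha_le (Y - nb v) b"
  using alpha_le_remove(1)[OF assms(1), of "{v}"] assms(2) by (simp add: indep_def)

section \<open>Codegrees and repeated neighbours\<close>

lemma codeg_sum:
  "(\<Sum>u\<in>nb v - {v}. codeg v u) = (\<Sum>B\<in>{B\<in>F. v \<in> B}. card B - 1)"
proof -
  have "(\<Sum>u\<in>nb v - {v}. codeg v u) = (\<Sum>u\<in>nb v - {v}. \<Sum>B\<in>{B\<in>F. v \<in> B}. if u \<in> B then 1 else 0)"
  proof (intro sum.cong refl)
    fix u
    have "codeg v u = card {B \<in> {B\<in>F. v \<in> B}. u \<in> B}"
      by (simp add: codeg_def conj_assoc)
    also have "\<dots> = (\<Sum>B\<in>{B\<in>F. v \<in> B}. if u \<in> B then 1 else 0)"
      by (simp only: card_eq_sum sum.inter_filter[OF fin_sub])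
    finally show "codeg v u = (\<Sum>B\<in>{B\<in>F. v \<in> B}. if u \<in> B then 1 else 0)" .
  qed
  also have "\<dots> = (\<Sum>B\<in>{B\<in>F. v \<in> B}. \<Sum>u\<in>nb v - {v}. if u \<in> B then 1 else 0)"
    by (rule sum.swap)
  also have "\<dots> = (\<Sum>B\<in>{B\<in>F. v \<in> B}. card B - 1)"
  proof (intro sum.cong refl)
    fix B assume B: "B \<in> {B \<in> F. v \<in> B}"
    have "{u \<in> nb v - {v}. u \<in> B} = B - {v}"
      using B block_sub_nb by auto
    then show "(\<Sum>u\<in>nb v - {v}. if u \<in> B then 1 else 0) = card B - 1"
      using B finB sum.inter_filter[of "nb v - {v}" "\<lambda>_. 1::nat" "\<lambda>u. u \<in> B"]
      by (simp add: card_Diff_singleton)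
  qed
  finally show ?thesis .
qed

lemma codeg_sum_le: "(\<Sum>u\<in>nb v - {v}. codeg v u) \<le> 5 * deg v"
proof -
  have "(\<Sum>B\<in>{B\<in>F. v \<in> B}. card B - 1) \<le> (\<Sum>B\<in>{B\<in>F. v \<in> B}. 5)"
    by (intro sum_mono) (use cardB in fastforce)
  then show ?thesis by (simp add: codeg_sum deg_def)
qed

lemma codeg_pos: "u \<in> nb v - {v} \<Longrightarrow> 1 \<le> codeg v u"
proof -
  assume "u \<in> nb v - {v}"
  then obtain B where "B \<in> {B \<in> F. v \<in> B \<and> u \<in> B}" by (auto simp: nb_def)
  then have "0 < card {B \<in> F. v \<in> B \<and> u \<in> B}" using finF by (subst card_gt_0_iff) auto
  then show ?thesis by (simp add: codeg_def)
qed

lemma card_nb: "card (nb v) \<le> 5 * deg v + 1"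
proof -
  have "card (nb v - {v}) \<le> (\<Sum>u\<in>nb v - {v}. codeg v u)"
    using sum_mono[of "nb v - {v}" "\<lambda>_. 1" "codeg v"] codeg_pos by simp
  then show ?thesis using codeg_sum_le[of v] by (simp add: card_Diff_singleton)
qed

text \<open>A point of degree 3 has 15 places for its neighbours; if at least 14 neighbours are
  distinct, only one place is lost to a repetition.\<close>

lemma codeg_loss:
  assumes "deg v = 3" "15 \<le> card (nb v)"
  shows "u \<noteq> v \<Longrightarrow> codeg v u \<le> 2"
    and "u \<noteq> v \<Longrightarrow> w \<noteq> v \<Longrightarrow> 2 \<le> codeg v u \<Longrightarrow> 2 \<le> codeg v w \<Longrightarrow> u = w"
proof -
  let ?N = "nb v - {v}"
  have N: "14 \<le> card ?N" "finite ?N" using assms by (simp_all add: card_Diff_singleton)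
  have le: "(\<Sum>u\<in>?N. codeg v u) \<le> 15" using codeg_sum_le[of v] assms by simp
  have mem: "u \<in> ?N" if "u \<noteq> v" "1 \<le> codeg v u" for u
  proof -
    have "{B \<in> F. v \<in> B \<and> u \<in> B} \<noteq> {}" using that(2) unfolding codeg_def by (metis card.empty not_one_le_zero)
    then show ?thesis using that by (auto simp: nb_def)
  qed
  have s: "(\<Sum>u\<in>?N. codeg v u - 1) \<le> 1"
  proof -
    have "(\<Sum>u\<in>?N. codeg v u) = (\<Sum>u\<in>?N. (codeg v u - 1) + 1)"
      by (intro sum.cong refl) (use codeg_pos in force)
    also have "\<dots> = (\<Sum>u\<in>?N. codeg v u - 1) + card ?N" by (subst sum.distrib) simp
    finally show ?thesis using le N by linarith
  qed
  show "codeg v u \<le> 2" if "u \<noteq> v"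
  proof (rule ccontr)
    assume c: "\<not> codeg v u \<le> 2"
    then have "u \<in> ?N" using mem that by simp
    then have "codeg v u - 1 \<le> 1" using s member_le_sum[of u ?N "\<lambda>u. codeg v u - 1"] N by fastforce
    then show False using c by simp
  qed
  show "u = w" if "u \<noteq> v" "w \<noteq> v" "2 \<le> codeg v u" "2 \<le> codeg v w"
  proof (rule ccontr)
    assume ne: "u \<noteq> w"
    have "{u, w} \<subseteq> ?N" using mem that by auto
    then have "(\<Sum>u\<in>{u,w}. codeg v u - 1) \<le> 1"
      using s sum_mono2[of ?N "{u,w}" "\<lambda>u. codeg v u - 1"] N by fastforce
    then show False using ne that by simp
  qed
qed

lemma deg_ne3_le_exc:
  assumes "finite Y" "\<And>v. v \<in> Y \<Longrightarrow> 3 \<le> deg v"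
  shows "card {v \<in> Y. deg v \<noteq> 3} \<le> exc Y"
proof -
  have "card {v \<in> Y. deg v \<noteq> 3} = (\<Sum>v\<in>{v \<in> Y. deg v \<noteq> 3}. 1)" by simp
  also have "\<dots> \<le> (\<Sum>v\<in>{v \<in> Y. deg v \<noteq> 3}. deg v - 3)"
    by (intro sum_mono) (use assms in force)
  also have "\<dots> \<le> exc Y" unfolding exc_def by (intro sum_mono2) (use assms in auto)
  finally show ?thesis .
qed

lemma exc_mono: "finite Y \<Longrightarrow> Z \<subseteq> Y \<Longrightarrow> exc Z \<le> exc Y"
  unfolding exc_def by (intro sum_mono2) auto

text \<open>A point of least degree d removes at most 5 d + 1 points, each of excess at least d - 3.
  The weight 4 is the largest integer that works: degree 4 requires 3 * 21 <= 64, whereas weight 5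
  would require 4 * 21 <= 80. The bound is crude, but it holds for every b.\<close>

lemma greedy_bound:
  assumes "alpha_le Y b" "\<And>v. v \<in> Y \<Longrightarrow> 3 \<le> deg v"
  shows "4 * card Y \<le> 64 * b + exc Y"
  using assms
proof (induction b arbitrary: Y)
  case 0
  then show ?case using alpha_le_0 by force
next
  case (Suc b)
  show ?case
  proof (cases "Y = {}")
    case False
    have fin: "finite Y" using Suc.prems by (simp add: alpha_le_def)
    obtain v where v: "v \<in> Y" and vmin: "\<And>u. u \<in> Y \<Longrightarrow> deg v \<le> deg u"
      using False ex_has_least_nat[of "\<lambda>v. v \<in> Y" _ deg] by blast
    let ?P = "Y \<inter> nb v" and ?Z = "Y - nb v"
    have IH: "4 * card ?Z \<le> 64 * b + exc ?Z"
      using Suc.IH[OF alpha_le_remove1[OF Suc.prems(1) v]] Suc.prems(2) by simp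
    have split: "card Y = card ?P + card ?Z" "exc Y = exc ?P + exc ?Z"
      using fin by (simp_all add: exc_def card_Int_Diff sum.Int_Diff[of Y _ "nb v"])
    have "card ?P * (deg v - 3) \<le> exc ?P"
      unfolding exc_def using sum_mono[of ?P "\<lambda>_. deg v - 3" "\<lambda>u. deg u - 3"] vmin
      by (simp add: diff_le_mono)
    moreover have cP: "card ?P \<le> 5 * deg v + 1"
      using card_nb[of v] card_mono[of "nb v" ?P] by simp
    moreover have "4 * card ?P \<le> 64 + card ?P * (deg v - 3)"
    proof -
      have "3 \<le> deg v" using v Suc.prems by simp
      then consider "deg v = 3" | "deg v = 4" | "deg v = 5" | "deg v = 6" | "4 \<le> deg v - 3" by linarith
      then show ?thesis
      proof cases
        case 5
        from mult_le_mono2[OF this, of "card ?P"] show ?thesis by linarith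
      qed (use cP in auto)
    qed
    ultimately show ?thesis using IH split by simp
  qed simp
qed

section \<open>Cliques of points of degree 3\<close>

lemma codeg_ge2:
  assumes "B \<in> F" "C \<in> F" "B \<noteq> C" "{u, v} \<subseteq> B" "{u, v} \<subseteq> C"
  shows "2 \<le> codeg u v"
proof -
  have "card {B, C} \<le> codeg u v"
    unfolding codeg_def using assms by (intro card_mono) auto
  then show ?thesis using assms by simp
qed

lemma codeg_ge3:
  assumes "B \<in> F" "C \<in> F" "D \<in> F" "B \<noteq> C" "B \<noteq> D" "C \<noteq> D" "{u, v} \<subseteq> B" "{u, v} \<subseteq> C" "{u, v} \<subseteq> D"
  shows "3 \<le> codeg u v"
proof -
  have "card {B, C, D} \<le> codeg u v"
    unfolding codeg_def using assms by (intro card_mono) auto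
  then show ?thesis using assms by simp
qed

text \<open>The counterpart of Fisher's inequality: a point outside a block of a clique reaches that
  block through only three blocks, which forces repeated pairs, and every point tolerates just
  one repeated neighbour.\<close>

lemma small_clique:
  assumes cl: "clique L" and d3: "\<And>v. v \<in> L \<Longrightarrow> deg v = 3"
    and big: "\<And>v. v \<in> L \<Longrightarrow> 15 \<le> card (nb v)"
    and fin: "finite L"
  shows "card L \<le> 7"
proof (rule ccontr)
  assume c8: "\<not> card L \<le> 7"
  have le2: "codeg u v \<le> 2" if "u \<in> L" "v \<noteq> u" for u v
    using codeg_loss(1)[OF d3 big] that by blast
  have uni: "v = w" if "u \<in> L" "v \<noteq> u" "w \<noteq> u" "2 \<le> codeg u v" "2 \<le> codeg u w" for u v w
    using codeg_loss(2)[OF d3 big] that by blast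
  have inter: "card (B \<inter> C) \<le> 2" if "B \<in> F" "C \<in> F" "B \<noteq> C" "p \<in> L" "p \<in> B" "p \<in> C" for B C p
  proof -
    have "B \<inter> C - {p} \<subseteq> {v}" if "v \<in> B \<inter> C - {p}" for v
      using uni[of p] codeg_ge2[of B C p] that \<open>B \<in> F\<close> \<open>C \<in> F\<close> \<open>B \<noteq> C\<close> \<open>p \<in> L\<close> \<open>p \<in> B\<close> \<open>p \<in> C\<close>
      by auto
    then have "card (B \<inter> C - {p}) \<le> 1"
      by (metis card_mono card_eq_0_iff ex_in_conv finite.emptyI finite_insert is_singletonI is_singleton_altdef le_zero_eq less_one nat_le_linear)
    then show ?thesis using that by (simp add: card_Diff_singleton)
  qed
  have trace2: "card (C \<inter> B \<inter> L) \<le> 2" if "B \<in> F" "C \<in> F" "C \<noteq> B" for B C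
  proof (cases "C \<inter> B \<inter> L = {}")
    case False
    then obtain p where p: "p \<in> C" "p \<in> B" "p \<in> L" by blast
    have "card (C \<inter> B \<inter> L) \<le> card (B \<inter> C)"
      using finB that by (intro card_mono) auto
    also have "\<dots> \<le> 2" using inter[of B C p] that p by blast
    finally show ?thesis .
  qed simp
  have fL: "card (L - B) = card L - card (B \<inter> L)" for B
    using fin by (simp add: card_Diff_subset_Int Int_commute)
  \<comment> \<open>Blocks that meet B in a pair of points of L. These pairs are disjoint: a common
    point would have two repeated neighbours, or one neighbour in three common blocks.\<close>
  define Dbl where "Dbl B = {C \<in> F. C \<noteq> B \<and> card (C \<inter> B \<inter> L) = 2}" for B
  have fDbl: "finite (Dbl B)" for B unfolding Dbl_def by simp
  have dis: "C \<inter> C' \<inter> B \<inter> L = {}" if h: "B \<in> F" "C \<in> Dbl B" "C' \<in> Dbl B" "C \<noteq> C'" for B C C'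
  proof (rule ccontr)
    assume "C \<inter> C' \<inter> B \<inter> L \<noteq> {}"
    then obtain p where p: "p \<in> C" "p \<in> C'" "p \<in> B" "p \<in> L" by blast
    obtain q where q: "q \<in> C \<inter> B \<inter> L" "q \<noteq> p"
      using h(2) p unfolding Dbl_def card_2_iff by auto
    obtain q' where q': "q' \<in> C' \<inter> B \<inter> L" "q' \<noteq> p"
      using h(3) p unfolding Dbl_def card_2_iff by auto
    have ne: "B \<noteq> C" "B \<noteq> C'" using h by (simp_all add: Dbl_def, blast+)
    have "2 \<le> codeg p q" using p q h ne by (intro codeg_ge2[of B C]) (simp_all add: Dbl_def)
    moreover have "2 \<le> codeg p q'" using p q' h ne by (intro codeg_ge2[of B C']) (simp_all add: Dbl_def)
    ultimately have "q = q'" using uni[OF p(4)] q q' by blast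
    then have "q \<in> C'" using q' by blast
    then have "3 \<le> codeg p q"
      using p q h ne by (intro codeg_ge3[of B C C']) (simp_all add: Dbl_def)
    then show False using le2[OF p(4) q(2)] by simp
  qed
  have cDbl: "2 * card (Dbl B) \<le> card (B \<inter> L)" if "B \<in> F" for B
  proof -
    have "card (\<Union>C\<in>Dbl B. C \<inter> B \<inter> L) = (\<Sum>C\<in>Dbl B. card (C \<inter> B \<inter> L))"
      using dis[OF that] fin fDbl by (intro card_UN_disjoint) (blast intro: finite_subset)+
    also have "\<dots> = 2 * card (Dbl B)" unfolding Dbl_def by simp
    finally have "2 * card (Dbl B) = card (\<Union>C\<in>Dbl B. C \<inter> B \<inter> L)" by simp
    also have "\<dots> \<le> card (B \<inter> L)" using fin by (intro card_mono) auto
    finally show ?thesis .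
  qed
  \<comment> \<open>The three blocks through u must cover the trace of B on L; each covers one
    point, or two if it lies in \<open>Dbl B\<close>.\<close>
  have ku: "card (B \<inter> L) \<le> 3 + card {C \<in> Dbl B. u \<in> C}" if "B \<in> F" "u \<in> L - B" for B u
  proof -
    let ?U = "{C \<in> F. u \<in> C}"
    have sub: "B \<inter> L \<subseteq> (\<Union>C\<in>?U. C \<inter> B \<inter> L)"
    proof
      fix q assume q: "q \<in> B \<inter> L"
      then have "adj u q" using cl that unfolding clique_def by (metis DiffE IntE)
      then show "q \<in> (\<Union>C\<in>?U. C \<inter> B \<inter> L)" using q by (auto simp: adj_def)
    qed
    have "card (B \<inter> L) \<le> card (\<Union>C\<in>?U. C \<inter> B \<inter> L)"
      using sub fin by (intro card_mono) auto
    also have "\<dots> \<le> (\<Sum>C\<in>?U. card (C \<inter> B \<inter> L))" by (intro card_UN_le) simp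
    also have "\<dots> \<le> (\<Sum>C\<in>?U. 1 + (if C \<in> Dbl B then 1 else 0))"
    proof (intro sum_mono)
      fix C assume C: "C \<in> ?U"
      then have "card (C \<inter> B \<inter> L) \<le> 2" using trace2[of B C] that by blast
      moreover have "C \<noteq> B" using C that by blast
      ultimately show "card (C \<inter> B \<inter> L) \<le> 1 + (if C \<in> Dbl B then 1 else 0)"
        using C by (auto simp: Dbl_def)
    qed
    also have "\<dots> = card ?U + card {C \<in> ?U. C \<in> Dbl B}"
      by (subst sum.distrib) (simp add: sum.inter_filter[symmetric])
    also have "card ?U = 3" using d3[of u] that by (simp add: deg_def)
    also have "{C \<in> ?U. C \<in> Dbl B} = {C \<in> Dbl B. u \<in> C}" by (auto simp: Dbl_def)
    finally show ?thesis .
  qed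
  have kle: "card {C \<in> Dbl B. u \<in> C} \<le> card (Dbl B)" for B u
    using fDbl by (intro card_mono) auto
  have all_Dbl: "{C \<in> Dbl B. u \<in> C} = Dbl B" if "card (Dbl B) \<le> card {C \<in> Dbl B. u \<in> C}" for B u
    using that fDbl by (intro card_seteq) auto
  \<comment> \<open>With a trace of 6 or 5 points, every outer point lies on all blocks of
    \<open>Dbl B\<close>, three or two in number. Then two outer points share three blocks, or one
    outer point shares two blocks with each of two others.\<close>
  have s6: "card (B \<inter> L) \<le> 4" if BF: "B \<in> F" for B
  proof (rule ccontr)
    assume s5: "\<not> card (B \<inter> L) \<le> 4"
    have "card (B \<inter> L) \<le> 6"
      using card_mono[OF finB[OF BF], of "B \<inter> L"] cardB[OF BF] by auto
    then consider "card (B \<inter> L) = 6" | "card (B \<inter> L) = 5" using s5 by linarith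
    then show False
    proof cases
      case 1
      have "2 \<le> card (L - B)" using 1 c8 fL[of B] by simp
      then obtain u w where uw: "u \<in> L - B" "w \<in> L - B" "u \<noteq> w"
        using card_le_Suc0_iff_eq[of "L - B"] fin by fastforce
      have "card (Dbl B) \<le> 3" using cDbl[OF BF] 1 by linarith
      then have D: "card (Dbl B) = 3" "{C \<in> Dbl B. u \<in> C} = Dbl B" "{C \<in> Dbl B. w \<in> C} = Dbl B"
        using ku[OF BF uw(1)] ku[OF BF uw(2)] kle[of B u] kle[of B w] 1 all_Dbl[of B u] all_Dbl[of B w]
        by linarith+
      then obtain C1 C2 C3 where "Dbl B = {C1, C2, C3}" "C1 \<noteq> C2" "C1 \<noteq> C3" "C2 \<noteq> C3"
        by (metis card_3_iff)
      then have "3 \<le> codeg u w"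
        using D(2,3) by (intro codeg_ge3[of C1 C2 C3]) (auto simp: Dbl_def)
      then show False using le2[of u w] uw by auto
    next
      case 2
      have "3 \<le> card (L - B)" using 2 c8 fL[of B] by simp
      then obtain u w z where uw: "{u, w, z} \<subseteq> L - B" "u \<noteq> w" "u \<noteq> z" "w \<noteq> z"
        using obtain_subset_with_card_n[of 3 "L - B"] by (metis card_3_iff)
      have "card (Dbl B) \<le> 2" using cDbl[OF BF] 2 by linarith
      then have D: "{C \<in> Dbl B. x \<in> C} = Dbl B \<and> card (Dbl B) = 2" if "x \<in> L - B" for x
        using ku[OF BF that] kle[of B x] 2 all_Dbl[of B x] by linarith
      then obtain C1 C2 where C: "Dbl B = {C1, C2}" "C1 \<noteq> C2"
        using uw(1) by (metis card_2_iff insert_subset)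
      have CD: "C1 \<in> F" "C2 \<in> F" using C by (simp_all add: Dbl_def set_eq_iff, metis+)
      have mem: "x \<in> C1" "x \<in> C2" if "x \<in> {u, w, z}" for x
      proof -
        have "{C \<in> Dbl B. x \<in> C} = {C1, C2}" using D[of x] C uw(1) that by auto
        then show "x \<in> C1" "x \<in> C2" by blast+
      qed
      have "2 \<le> codeg u w" "2 \<le> codeg u z"
        using mem codeg_ge2[OF CD C(2)] by simp_all
      then show False using uni[of u w z] uw by auto
    qed
  qed
  \<comment> \<open>The outer points are split into pairs by the two blocks C, C' of
    \<open>Dbl B\<close>. A point of C on B has used up B and C, so both outer points u, w of C' lie
    on its third block. The other point of C on B yields a different such block, and together with
    C' the points u, w share three.\<close>
  have s4: "card (B \<inter> L) \<noteq> 4" if BF: "B \<in> F" for B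
  proof
    assume 4: "card (B \<inter> L) = 4"
    have LB: "4 \<le> card (L - B)" using 4 c8 fL[of B] by simp
    have cover: "L - B \<subseteq> (\<Union>C\<in>Dbl B. C \<inter> L - B)"
    proof
      fix u assume u: "u \<in> L - B"
      then have "card {C \<in> Dbl B. u \<in> C} \<noteq> 0" using ku[OF BF u] 4 by simp
      then have "{C \<in> Dbl B. u \<in> C} \<noteq> {}" by (metis card.empty)
      then show "u \<in> (\<Union>C\<in>Dbl B. C \<inter> L - B)" using u by blast
    qed
    have C2: "card (C \<inter> L - B) \<le> 2" if "C \<in> Dbl B" for C
    proof -
      have "card (C \<inter> L) = card (C \<inter> L \<inter> B) + card (C \<inter> L - B)"
        using fin by (intro card_Int_Diff) simp
      moreover have "C \<inter> L \<inter> B = C \<inter> B \<inter> L" by blast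
      moreover have "card (C \<inter> L) \<le> 4" "card (C \<inter> B \<inter> L) = 2"
        using that s6[of C] by (auto simp: Dbl_def)
      ultimately show ?thesis by simp
    qed
    have "4 \<le> card (\<Union>C\<in>Dbl B. C \<inter> L - B)"
      using LB card_mono[OF _ cover] fin fDbl by (meson finite_Diff finite_Int finite_UN_I le_trans)
    also have "\<dots> \<le> (\<Sum>C\<in>Dbl B. card (C \<inter> L - B))" using fDbl by (intro card_UN_le)
    also have "\<dots> \<le> (\<Sum>C\<in>Dbl B. 2)" by (intro sum_mono C2)
    finally have "card (Dbl B) = 2" using cDbl[OF BF] 4 by simp
    then obtain C C' where C: "Dbl B = {C, C'}" "C \<noteq> C'" by (metis card_2_iff)
    have CF: "C \<in> F" "C' \<in> F" "C \<noteq> B" "C' \<noteq> B" using C by (auto simp: Dbl_def)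
    have un: "card ((C \<inter> L - B) \<union> (C' \<inter> L - B)) + card ((C \<inter> L - B) \<inter> (C' \<inter> L - B))
        = card (C \<inter> L - B) + card (C' \<inter> L - B)"
      using fin by (intro card_Un_Int[symmetric]) auto
    have "4 \<le> card ((C \<inter> L - B) \<union> (C' \<inter> L - B))"
      using LB card_mono[OF _ cover] fin C by auto
    with un C2[of C] C2[of C'] C have c0: "card ((C \<inter> L - B) \<inter> (C' \<inter> L - B)) = 0" "card (C' \<inter> L - B) = 2"
      by auto
    then have dj: "(C \<inter> L - B) \<inter> (C' \<inter> L - B) = {}" using fin by simp
    obtain u w where uw: "C' \<inter> L - B = {u, w}" "u \<noteq> w" using c0(2) by (metis card_2_iff)
    have "card (C \<inter> B \<inter> L) = 2" using C by (auto simp: Dbl_def)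
    then obtain p p' where p: "C \<inter> B \<inter> L = {p, p'}" "p \<noteq> p'" by (metis card_2_iff)
    have third: "\<exists>D\<in>F. q \<in> D \<and> q' \<notin> D \<and> u \<in> D \<and> w \<in> D \<and> D \<noteq> C'"
      if q: "q \<in> C \<inter> B \<inter> L" "q' \<in> C \<inter> B \<inter> L" "q \<noteq> q'" for q q'
    proof -
      have "C \<inter> C' \<inter> B \<inter> L = {}" using dis[OF BF, of C C'] C by simp
      then have qC': "q \<notin> C'" using q(1) by blast
      have uB: "u \<notin> B" "w \<notin> B" "u \<notin> C" "w \<notin> C" "u \<in> L" "w \<in> L" using uw dj by blast+
      have "q \<noteq> u" "q \<noteq> w" using q uB by blast+
      then have "adj q u" "adj q w" using cl uB q(1) unfolding clique_def by simp_all
      then obtain D D' where D: "D \<in> F" "q \<in> D" "u \<in> D" "D' \<in> F" "q \<in> D'" "w \<in> D'"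
        unfolding adj_def by blast
      have "D = D'"
      proof (rule ccontr)
        assume "D \<noteq> D'"
        moreover have ne: "B \<noteq> D" "B \<noteq> D'" "C \<noteq> D" "C \<noteq> D'" using D uB by blast+
        ultimately have "card {B, C, D, D'} = 4" using CF(3) by simp
        moreover have "card {B, C, D, D'} \<le> deg q"
          unfolding deg_def using D CF BF q by (intro card_mono) auto
        ultimately show False using d3[of q] q by simp
      qed
      moreover have "q' \<notin> D"
      proof
        assume "q' \<in> D"
        then have "3 \<le> codeg q q'"
          using D uB q CF BF by (intro codeg_ge3[of B C D]; blast)
        then show False using le2[of q q'] q by auto
      qed
      ultimately show ?thesis using D qC' by blast
    qed
    obtain D where D: "D \<in> F" "p \<in> D" "p' \<notin> D" "u \<in> D" "w \<in> D" "D \<noteq> C'"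
      using third[of p p'] p by blast
    obtain D' where D': "D' \<in> F" "p' \<in> D'" "p \<notin> D'" "u \<in> D'" "w \<in> D'" "D' \<noteq> C'"
      using third[of p' p] p by blast
    have "3 \<le> codeg u w"
      using D D' uw CF by (intro codeg_ge3[of C' D D']; blast)
    then show False using le2[of u w] uw by auto
  qed
  \<comment> \<open>All traces now have at most three points, so v reaches at most two others on
    each of its three blocks. The traces can form a Fano plane, which has exactly 7 points.\<close>
  obtain v where v: "v \<in> L" using c8 by fastforce
  have "L - {v} \<subseteq> (\<Union>B\<in>{B\<in>F. v \<in> B}. B \<inter> L - {v})"
    using cl v unfolding clique_def adj_def by blast
  then have "card (L - {v}) \<le> card (\<Union>B\<in>{B\<in>F. v \<in> B}. B \<inter> L - {v})"
    using fin by (intro card_mono) auto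
  also have "\<dots> \<le> (\<Sum>B\<in>{B\<in>F. v \<in> B}. card (B \<inter> L - {v}))" by (intro card_UN_le) simp
  also have "\<dots> \<le> (\<Sum>B\<in>{B\<in>F. v \<in> B}. 2)"
  proof (intro sum_mono)
    fix B assume B: "B \<in> {B\<in>F. v \<in> B}"
    then have "card (B \<inter> L) \<le> 3" using s6[of B] s4[of B] by fastforce
    then show "card (B \<inter> L - {v}) \<le> 2" using B v by (simp add: card_Diff_singleton)
  qed
  also have "\<dots> = 6" using d3[OF v] by (simp add: deg_def)
  finally show False using c8 v by (simp add: card_Diff_singleton)
qed

section \<open>Regions of minimum degree 3\<close>

lemma clique_sub_nb:
  assumes "clique K" "w \<in> K"
  shows "K \<subseteq> nb w"
proof
  fix x assume "x \<in> K"
  then show "x \<in> nb w" using assms by (cases "x = w") (auto simp: clique_def in_nb)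
qed

lemma card_nb3: "deg v = 3 \<Longrightarrow> card (nb v) \<le> 16"
  using card_nb[of v] by simp

lemma card_Diff_UN_nb:
  assumes "finite Y" "finite W" "\<And>w. w \<in> W \<Longrightarrow> deg w = 3"
  shows "card Y \<le> card (Y - (\<Union>x\<in>W. nb x)) + 16 * card W"
proof -
  have "card (\<Union>x\<in>W. nb x) \<le> (\<Sum>x\<in>W. card (nb x))" using assms(2) by (rule card_UN_le)
  also have "\<dots> \<le> (\<Sum>x\<in>W. 16)" by (intro sum_mono card_nb3 assms(3))
  finally have "card (\<Union>x\<in>W. nb x) \<le> 16 * card W" by simp
  moreover have "card Y - card (\<Union>x\<in>W. nb x) \<le> card (Y - (\<Union>x\<in>W. nb x))"
    using assms by (intro diff_card_le_card_Diff) simp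
  ultimately show ?thesis by linarith
qed

text \<open>When all neighbourhoods of degree-3 points are almost complete, a maximal independent set of
  such points leaves a clique which contains at most 7 of them and hence many points of larger
  degree. Restarting from a point of that clique yields \<open>b\<close> disjoint such cliques.\<close>

lemma sparse_excess:
  assumes al: "alpha_le Y b" and b: "1 \<le> b"
    and d3: "\<And>v. v \<in> Y \<Longrightarrow> 3 \<le> deg v"
    and big: "\<And>v. v \<in> Y \<Longrightarrow> deg v = 3 \<Longrightarrow> 15 \<le> card (nb v \<inter> Y)"
    and small: "exc Y + 16 * b < card Y + 16"
  shows "b * (card Y + 9) \<le> exc Y + 16 * b * b"
proof -
  have fin: "finite Y" using al by (rule alpha_finite)
  define T where "T = {v \<in> Y. deg v = 3}"
  define Q where "Q = {v \<in> Y. deg v \<noteq> 3}"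
  have Q: "card Q \<le> exc Y" unfolding Q_def using fin d3 by (rule deg_ne3_le_exc)
  have fQ: "finite Q" using fin by (simp add: Q_def)
  have rest: "card Y \<le> card (Y - (\<Union>x\<in>W. nb x)) + 16 * card W" if "W \<subseteq> T" for W
    using that fin by (intro card_Diff_UN_nb) (auto simp: T_def intro: finite_subset)
  \<comment> \<open>Otherwise the neighbourhoods of W, at most 16 points each, leave only points
    that are charged to the excess, against \<open>small\<close>.\<close>
  have point: "\<exists>v\<in>T. v \<notin> (\<Union>x\<in>W. nb x)" if "W \<subseteq> T" "card W + 1 \<le> b" for W
  proof (rule ccontr)
    assume "\<not> (\<exists>v\<in>T. v \<notin> (\<Union>x\<in>W. nb x))"
    then have "Y - (\<Union>x\<in>W. nb x) \<subseteq> Q" by (auto simp: T_def Q_def)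
    then have "card (Y - (\<Union>x\<in>W. nb x)) \<le> exc Y"
      using Q card_mono[OF fQ] le_trans by blast
    then show False using rest[OF that(1)] small that(2) by linarith
  qed
  have extend: "\<exists>W'. W \<subseteq> W' \<and> W' \<subseteq> T \<and> indep W' \<and> card W' + 1 = b"
    if "W \<subseteq> T" "indep W" "card W + 1 \<le> b" for W
    using that
  proof (induction "b - 1 - card W" arbitrary: W)
    case 0
    then show ?case by (intro exI[of _ W]) auto
  next
    case (Suc n)
    obtain v where v: "v \<in> T" "v \<notin> (\<Union>x\<in>W. nb x)" using point Suc.prems by blast
    have "v \<notin> W" using v nb_self by blast
    moreover have "finite W" using Suc.prems(1) fin by (auto simp: T_def intro: finite_subset)
    ultimately have "card (insert v W) = Suc (card W)" by simp
    moreover have "indep (insert v W)" using indep_insert Suc.prems(2) v(2) by blast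
    ultimately have "\<exists>W'. insert v W \<subseteq> W' \<and> W' \<subseteq> T \<and> indep W' \<and> card W' + 1 = b"
      using Suc.hyps(2) Suc.prems v(1) by (intro Suc.hyps(1)) auto
    then show ?case by blast
  qed
  have step: "\<exists>W. W \<subseteq> T \<and> indep W \<and> card W = t \<and>
      t * (card Y + 9) \<le> card (Q \<inter> (\<Union>x\<in>W. nb x)) + 16 * b * t" if "t \<le> b" for t
    using that
  proof (induction t)
    case 0
    show ?case by (intro exI[of _ "{}"]) (simp add: indep_def)
  next
    case (Suc t)
    then obtain W where W: "W \<subseteq> T" "indep W" "card W = t"
      "t * (card Y + 9) \<le> card (Q \<inter> (\<Union>x\<in>W. nb x)) + 16 * b * t" by auto
    obtain W' where W': "W \<subseteq> W'" "W' \<subseteq> T" "indep W'" "card W' + 1 = b"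
      using extend[OF W(1,2)] W(3) Suc.prems by auto
    define K where "K = Y - (\<Union>x\<in>W'. nb x)"
    have WY: "W' \<subseteq> Y" using W' by (auto simp: T_def)
    have fW: "finite W" using W(1) fin by (auto simp: T_def intro: finite_subset)
    have "b - card W' = 1" using W'(4) by simp
    then have cl: "clique K"
      using alpha_le_remove(1)[OF al WY W'(3)] alpha_le_1_clique by (simp add: K_def)
    have cK: "card Y + 16 \<le> card K + 16 * b"
      using rest[OF W'(2)] W'(4) unfolding K_def by linarith
    have "card (K \<inter> T) \<le> 7"
    proof (rule small_clique)
      show "clique (K \<inter> T)" using cl by (auto simp: clique_def)
      show "deg v = 3" if "v \<in> K \<inter> T" for v using that by (simp add: T_def)
      show "15 \<le> card (nb v)" if "v \<in> K \<inter> T" for v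
        using that big[of v] card_mono[of "nb v" "nb v \<inter> Y"] by (simp add: T_def)
      show "finite (K \<inter> T)" using fin by (simp add: K_def)
    qed
    moreover have "card K = card (K \<inter> T) + card (K \<inter> Q)"
    proof -
      have "K = (K \<inter> T) \<union> (K \<inter> Q)" by (auto simp: K_def T_def Q_def)
      moreover have "card ((K \<inter> T) \<union> (K \<inter> Q)) = card (K \<inter> T) + card (K \<inter> Q)"
        using fin by (intro card_Un_disjoint) (auto simp: K_def T_def Q_def)
      ultimately show ?thesis by simp
    qed
    \<comment> \<open>9 = 16 - 7: at least \<open>card Y - 16 * (b - 1)\<close> points survive the
      deletion of b - 1 neighbourhoods, and at most 7 of them have degree 3.\<close>
    ultimately have KQ: "card Y + 9 \<le> card (K \<inter> Q) + 16 * b" using cK by linarith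
    \<comment> \<open>With w inside the clique, K lies in \<open>nb w\<close>, while K avoids the
      neighbourhoods of W. So its points of Q are counted here for the first time.\<close>
    obtain w where w: "w \<in> T" "w \<notin> (\<Union>x\<in>W'. nb x)" using point[OF W'(2)] W'(4) by auto
    have wK: "w \<in> K" using w by (simp add: K_def T_def)
    have wW: "w \<notin> (\<Union>x\<in>W. nb x)" using w(2) W'(1) by blast
    then have "w \<notin> W" using nb_self by blast
    have sub: "K \<subseteq> nb w" using cl wK by (rule clique_sub_nb)
    have "card (Q \<inter> (\<Union>x\<in>W. nb x)) + card (K \<inter> Q) = card ((Q \<inter> (\<Union>x\<in>W. nb x)) \<union> (K \<inter> Q))"
      using fQ W'(1) by (intro card_Un_disjoint[symmetric]) (auto simp: K_def)
    also have "\<dots> \<le> card (Q \<inter> (\<Union>x\<in>insert w W. nb x))"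
      using sub fQ by (intro card_mono) auto
    finally have "Suc t * (card Y + 9) \<le> card (Q \<inter> (\<Union>x\<in>insert w W. nb x)) + 16 * b * Suc t"
      using W(4) KQ by simp
    moreover have "indep (insert w W)" using indep_insert W(2) wW by blast
    moreover have "card (insert w W) = Suc t" using fW \<open>w \<notin> W\<close> W(3) by simp
    ultimately show ?case using w(1) W(1) by (intro exI[of _ "insert w W"]) auto
  qed
  obtain W where "b * (card Y + 9) \<le> card (Q \<inter> (\<Union>x\<in>W. nb x)) + 16 * b * b"
    using step[of b] by auto
  moreover have "card (Q \<inter> (\<Union>x\<in>W. nb x)) \<le> card Q" using fQ by (intro card_mono) auto
  ultimately show ?thesis using Q by linarith
qed

lemma exc_ge_card: "(\<And>v. v \<in> Y \<Longrightarrow> 4 \<le> deg v) \<Longrightarrow> card Y \<le> exc Y"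
  unfolding exc_def using sum_mono[of Y "\<lambda>_. 1" "\<lambda>v. deg v - 3"] by fastforce

text \<open>Deleting a neighbourhood of at most 14 points costs nothing against 14 b, so the
  critical case is that of \<open>sparse_excess\<close>. For b = 1 its estimate is the first
  conclusion, which explains the 7. The second one is stronger and serves larger regions; for b = 1
  it reflects that 17 points leave no room for a point of degree 3. At b = 4 the estimate just
  suffices for 57 points; at b = 5 it would be too weak for 71.\<close>

theorem excess_bound:
  assumes "alpha_le Y b" "\<And>v. v \<in> Y \<Longrightarrow> 3 \<le> deg v" "b \<le> 4" "14 * b < card Y"
  shows "card Y + 7 \<le> exc Y + 14 * b \<and> (14 * b + 3 \<le> card Y \<longrightarrow> card Y + 16 \<le> exc Y + 16 * b)"
  using assms
proof (induction b arbitrary: Y)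
  case 0
  then show ?case using alpha_le_0 by force
next
  case (Suc b)
  let ?b = "Suc b"
  have fin: "finite Y" using Suc.prems(1) by (rule alpha_finite)
  show ?case
  proof (cases "\<exists>v\<in>Y. deg v = 3 \<and> card (nb v \<inter> Y) \<le> 14")
    case True
    then obtain v where v: "v \<in> Y" "card (nb v \<inter> Y) \<le> 14" by blast
    have c: "card Y = card (Y \<inter> nb v) + card (Y - nb v)" using fin by (rule card_Int_Diff)
    have al: "alpha_le (Y - nb v) b" using alpha_le_remove1[OF Suc.prems(1) v(1)] .
    have "exc (Y - nb v) \<le> exc Y" using fin by (intro exc_mono) auto
    moreover have "card (Y - nb v) + 7 \<le> exc (Y - nb v) + 14 * b \<and>
        (14 * b + 3 \<le> card (Y - nb v) \<longrightarrow> card (Y - nb v) + 16 \<le> exc (Y - nb v) + 16 * b)"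
      using Suc.IH[OF al] Suc.prems c v(2) by (simp add: Int_commute)
    ultimately show ?thesis using c v(2) Suc.prems(3,4) by (auto simp: Int_commute)
  next
    case False
    then have big: "15 \<le> card (nb v \<inter> Y)" if "v \<in> Y" "deg v = 3" for v
      using that by force
    show ?thesis
    proof (cases "\<exists>v\<in>Y. deg v = 3")
      case False
      then have "4 \<le> deg v" if "v \<in> Y" for v using Suc.prems(2)[OF that] that by force
      then have "card Y \<le> exc Y" by (rule exc_ge_card)
      then show ?thesis using Suc.prems(3) by simp
    next
      case True
      show ?thesis
      proof (cases "exc Y + 16 * ?b < card Y + 16")
        case False
        then show ?thesis using Suc.prems(3) by auto
      next
        case small: True
        have main: "?b * (card Y + 9) \<le> exc Y + 16 * ?b * ?b"
          by (rule sparse_excess) (fact Suc.prems(1), simp, fact Suc.prems(2), fact big, fact small)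
        have "card Y \<le> 16" if b0: "b = 0"
        proof -
          obtain v where v: "v \<in> Y" "deg v = 3" using True by blast
          have "Y \<subseteq> nb v"
            using alpha_le_0[OF alpha_le_remove1[OF Suc.prems(1) v(1), unfolded b0]] by blast
          then show ?thesis using card_mono[of "nb v" Y] card_nb3[OF v(2)] by simp
        qed
        note 16 = this
        consider "b = 0" | "b = 1" | "b = 2" | "b = 3" using Suc.prems(3) by linarith
        then show ?thesis
        proof cases
          case 1
          then show ?thesis using 16 main by simp
        qed (use main Suc.prems(4) in simp_all)
      qed
    qed
  qed
qed

text \<open>By \<open>excess_bound\<close>, no neighbourhood leaves more than 14 (b - 1) points, so
  deleting one with at most 14 points leaves a tight region again. Recursion supplies some 14-clique
  K, and K turns out to be a full neighbourhood. Hence K can be deleted as well, and a point p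
  outside K is reached by induction.\<close>

theorem tight_cliques:
  assumes "alpha_le Y b" "\<And>v. v \<in> Y \<Longrightarrow> 3 \<le> deg v" "b \<le> 4" "card Y = 14 * b" "exc Y \<le> 3" "p \<in> Y"
  shows "\<exists>K\<subseteq>Y. p \<in> K \<and> card K = 14 \<and> clique K"
  using assms
proof (induction b arbitrary: Y p)
  case 0
  then show ?case using alpha_le_0 by force
next
  case (Suc b)
  let ?b = "Suc b"
  have fin: "finite Y" using Suc.prems(1) by (rule alpha_finite)
  have sub: "card (Y - nb v) \<le> 14 * b \<and> alpha_le (Y - nb v) b \<and> exc (Y - nb v) \<le> 3" if "v \<in> Y" for v
  proof -
    have al: "alpha_le (Y - nb v) b" using alpha_le_remove1[OF Suc.prems(1) that] .
    have e: "exc (Y - nb v) \<le> 3" using exc_mono[OF fin, of "Y - nb v"] Suc.prems(5) by auto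
    show ?thesis
    proof (rule ccontr)
      assume "\<not> ?thesis"
      then have "14 * b < card (Y - nb v)" using al e by simp
      then show False using excess_bound[OF al] Suc.prems(2,3) e by fastforce
    qed
  qed
  have "\<exists>v\<in>Y. deg v = 3 \<and> card (nb v \<inter> Y) \<le> 14"
  proof (rule ccontr)
    assume "\<not> ?thesis"
    then have big: "15 \<le> card (nb v \<inter> Y)" if "v \<in> Y" "deg v = 3" for v
      using that by force
    have small: "exc Y + 16 * ?b < card Y + 16" using Suc.prems(3,4,5) by simp
    \<comment> \<open>For four cliques and excess 3 this reads 260 <= 259, so 3 is the largest
      excess that is contradictory here.\<close>
    have main: "?b * (card Y + 9) \<le> exc Y + 16 * ?b * ?b"
      by (rule sparse_excess) (fact Suc.prems(1), simp, fact Suc.prems(2), fact big, fact small)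
    consider "b = 0" | "b = 1" | "b = 2" | "b = 3" using Suc.prems(3) by linarith
    then show False using main Suc.prems(4,5) by cases simp_all
  qed
  then obtain v where v: "v \<in> Y" "deg v = 3" "card (nb v \<inter> Y) \<le> 14" by blast
  have cv: "card Y = card (Y \<inter> nb v) + card (Y - nb v)" using fin by (rule card_Int_Diff)
  have cv': "card (Y - nb v) = 14 * b"
    using cv v(3) sub[OF v(1)] Suc.prems(4) by (simp add: Int_commute)
  obtain K where K: "K \<subseteq> Y" "card K = 14" "clique K"
  proof (cases "b = 0")
    case True
    have "clique Y" using Suc.prems(1) True alpha_le_1_clique by simp
    then show ?thesis using that[of Y] Suc.prems(4) True by simp
  next
    case False
    then have "Y - nb v \<noteq> {}" using cv' by force
    then obtain q where q: "q \<in> Y - nb v" by blast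
    have "\<exists>K\<subseteq>Y - nb v. q \<in> K \<and> card K = 14 \<and> clique K"
      by (rule Suc.IH) (use sub[OF v(1)] cv' Suc.prems(2,3) q in auto)
    then show ?thesis using that by blast
  qed
  have fK: "finite K" using K(1) fin by (rule finite_subset)
  let ?L = "{w \<in> K. deg w = 3 \<and> 15 \<le> card (nb w)}"
  let ?Q = "{w \<in> Y. deg w \<noteq> 3}"
  have "card ?L \<le> 7" by (rule small_clique) (use K(3) fK in \<open>auto simp: clique_def\<close>)
  moreover have "card ?Q \<le> 3"
    using deg_ne3_le_exc[OF fin Suc.prems(2)] Suc.prems(5) by simp
  \<comment> \<open>7 + 3 < 14, so some w in K has degree 3 and a closed neighbourhood of at most 14
    points, which must then be K.\<close>
  ultimately have "card (?L \<union> ?Q) < card K" using card_Un_le[of ?L ?Q] K(2) by linarith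
  then have "\<not> K \<subseteq> ?L \<union> ?Q" using fK fin card_mono[of "?L \<union> ?Q" K] by auto
  then obtain w where "w \<in> K" "w \<notin> ?L" "w \<notin> ?Q" by blast
  moreover from this have "deg w = 3" using K(1) by auto
  ultimately have w: "w \<in> K" "deg w = 3" "card (nb w) \<le> 14" by simp_all
  have "K \<subseteq> nb w" using K(3) w(1) by (rule clique_sub_nb)
  then have Kw: "nb w = K" using w(3) K(2) by (intro card_seteq[symmetric]) auto
  show ?case
  proof (cases "p \<in> K")
    case False
    have wY: "w \<in> Y" using w K by blast
    have "card (Y - nb w) = 14 * b"
      using Kw K fK Suc.prems(4) by (simp add: card_Diff_subset)
    then have "\<exists>K\<subseteq>Y - nb w. p \<in> K \<and> card K = 14 \<and> clique K"
      by (intro Suc.IH) (use sub[OF wY] Suc.prems(2,3,6) False Kw in auto)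
    then show ?thesis by blast
  qed (use K in auto)
qed

section \<open>Points of degree 2 as edges of a multigraph\<close>

text \<open>A point \<open>v\<close> of degree 2 is regarded as an edge between the two blocks \<open>ends v\<close>; independent sets
  of such points are matchings, with \<open>blks S\<close> the matched blocks and \<open>inn Y V\<close> the edges inside \<open>V\<close>.\<close>

definition ends :: "'a \<Rightarrow> 'a set set" where
  "ends v = {B \<in> F. v \<in> B}"

definition blks :: "'a set \<Rightarrow> 'a set set" where
  "blks S = (\<Union>x\<in>S. ends x)"

definition D2 :: "'a set \<Rightarrow> 'a set" where
  "D2 Y = {v \<in> Y. deg v = 2}"

definition inn :: "'a set \<Rightarrow> 'a set set \<Rightarrow> 'a set" where
  "inn Y V = {v \<in> D2 Y. ends v \<subseteq> V}"

definition maxind :: "'a set \<Rightarrow> 'a set \<Rightarrow> bool" where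
  "maxind Y S \<longleftrightarrow> S \<subseteq> D2 Y \<and> indep S \<and> (\<forall>I. I \<subseteq> D2 Y \<longrightarrow> indep I \<longrightarrow> card I \<le> card S)"

lemma ends_iff: "B \<in> ends v \<longleftrightarrow> B \<in> F \<and> v \<in> B"
  by (simp add: ends_def)

lemma finite_ends [simp]: "finite (ends v)"
  by (simp add: ends_def)

lemma deg_ends: "deg v = card (ends v)"
  by (simp add: ends_def deg_def)

lemma adj_ends: "adj u v \<longleftrightarrow> ends u \<inter> ends v \<noteq> {}"
  by (auto simp: adj_def ends_def)

lemma blks_sub: "blks S \<subseteq> F"
  by (auto simp: blks_def ends_def)

lemma indepI:
  "(\<And>u v. u \<in> I \<Longrightarrow> v \<in> I \<Longrightarrow> u \<noteq> v \<Longrightarrow> ends u \<inter> ends v = {}) \<Longrightarrow> indep I"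
  by (auto simp: indep_def adj_ends)

lemma indepD: "indep I \<Longrightarrow> u \<in> I \<Longrightarrow> v \<in> I \<Longrightarrow> B \<in> ends u \<Longrightarrow> B \<in> ends v \<Longrightarrow> u = v"
  by (auto simp: indep_def adj_ends)

lemma indep_exchange:
  assumes "indep S" "\<And>z v. z \<in> N \<Longrightarrow> v \<in> S - X \<Longrightarrow> ends z \<inter> ends v = {}"
    and "\<And>z v. z \<in> N \<Longrightarrow> v \<in> N \<Longrightarrow> z \<noteq> v \<Longrightarrow> ends z \<inter> ends v = {}"
  shows "indep (N \<union> (S - X))"
proof (rule indepI)
  fix u v assume "u \<in> N \<union> (S - X)" "v \<in> N \<union> (S - X)" "u \<noteq> v"
  then consider "u \<in> N" "v \<in> N" | "u \<in> N" "v \<in> S - X" | "v \<in> N" "u \<in> S - X" | "u \<in> S" "v \<in> S"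
    by blast
  then show "ends u \<inter> ends v = {}"
    by cases (use assms(2,3) \<open>u \<noteq> v\<close> indepD[OF assms(1), of u v] in blast)+
qed

lemma ends_other:
  assumes "deg v = 2" "B \<in> ends v"
  obtains C where "ends v = {B, C}" "B \<noteq> C"
proof -
  obtain P Q where "ends v = {P, Q}" "P \<noteq> Q"
    using assms(1) by (auto simp: deg_ends card_2_iff)
  then show ?thesis using assms(2) that[of Q] that[of P] by (auto simp: insert_commute)
qed

text \<open>Incidences between Y and V are counted twice over: a point of \<open>inn Y V\<close>
  contributes two of them. Inner edges therefore reduce the number of points that V covers.\<close>

lemma card_UN_inn:
  assumes "finite Y" "V \<subseteq> F"
  shows "card (\<Union>V \<inter> Y) + card (inn Y V) \<le> 6 * card V"
proof -
  have fV: "finite V" using assms(2) finF by (rule finite_subset)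
  have "(\<Sum>v\<in>Y. card (ends v \<inter> V)) = (\<Sum>v\<in>Y. \<Sum>B\<in>V. if v \<in> B then 1 else 0)"
  proof (intro sum.cong refl)
    fix v
    have "ends v \<inter> V = {B \<in> V. v \<in> B}" using assms(2) by (auto simp: ends_def)
    then show "card (ends v \<inter> V) = (\<Sum>B\<in>V. if v \<in> B then 1 else 0)"
      using fV by (simp only: card_eq_sum sum.inter_filter)
  qed
  also have "\<dots> = (\<Sum>B\<in>V. \<Sum>v\<in>Y. if v \<in> B then 1 else 0)" by (rule sum.swap)
  also have "\<dots> = (\<Sum>B\<in>V. card {v \<in> Y. v \<in> B})"
    using assms(1) by (simp only: card_eq_sum sum.inter_filter)
  also have "\<dots> \<le> (\<Sum>B\<in>V. 6)"
  proof (intro sum_mono)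
    fix B assume "B \<in> V"
    then have "B \<in> F" using assms(2) by blast
    then show "card {v \<in> Y. v \<in> B} \<le> 6"
      using card_mono[of B "{v \<in> Y. v \<in> B}"] finB cardB le_trans by blast
  qed
  finally have le: "(\<Sum>v\<in>Y. card (ends v \<inter> V)) \<le> 6 * card V" by simp
  have "card (\<Union>V \<inter> Y) + card (inn Y V)
      = (\<Sum>v\<in>Y. (if v \<in> \<Union>V then 1 else 0) + (if v \<in> inn Y V then 1 else 0))"
  proof -
    have "\<Union>V \<inter> Y = {v \<in> Y. v \<in> \<Union>V}" "inn Y V = {v \<in> Y. v \<in> inn Y V}"
      by (auto simp: inn_def D2_def)
    then show ?thesis
      using assms(1) sum.inter_filter[OF assms(1), of "\<lambda>_. 1::nat" "\<lambda>v. v \<in> \<Union>V"]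
        sum.inter_filter[OF assms(1), of "\<lambda>_. 1::nat" "\<lambda>v. v \<in> inn Y V"]
      by (simp add: sum.distrib)
  qed
  also have "\<dots> \<le> (\<Sum>v\<in>Y. card (ends v \<inter> V))"
  proof (intro sum_mono)
    fix v assume v: "v \<in> Y"
    have 1: "1 \<le> card (ends v \<inter> V)" if "v \<in> \<Union>V"
    proof -
      have "ends v \<inter> V \<noteq> {}" using that assms(2) by (auto simp: ends_def)
      then show ?thesis by (simp add: Suc_le_eq card_gt_0_iff)
    qed
    have 2: "card (ends v \<inter> V) = 2" if "v \<in> inn Y V"
      using that by (simp add: inn_def D2_def deg_ends Int_absorb2)
    show "(if v \<in> \<Union>V then 1 else 0) + (if v \<in> inn Y V then 1 else 0) \<le> card (ends v \<inter> V)"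
      using 1 2 by auto
  qed
  finally show ?thesis using le by simp
qed

section \<open>Maximum matchings, exchanges and augmenting paths\<close>

lemma maxind_finite: "finite Y \<Longrightarrow> maxind Y S \<Longrightarrow> finite S"
  by (auto simp: maxind_def D2_def intro: finite_subset)

lemma maxind_deg: "maxind Y S \<Longrightarrow> x \<in> S \<Longrightarrow> x \<in> Y \<and> deg x = 2"
  by (auto simp: maxind_def D2_def)

lemma maxind_card_le: "maxind Y S \<Longrightarrow> I \<subseteq> D2 Y \<Longrightarrow> indep I \<Longrightarrow> card I \<le> card S"
  by (simp add: maxind_def)

lemma maxind_hit:
  assumes "finite Y" "maxind Y S" "y \<in> D2 Y"
  shows "ends y \<inter> blks S \<noteq> {}"
proof
  assume e: "ends y \<inter> blks S = {}"
  have "ends y \<noteq> {}" using assms(3) by (auto simp: D2_def deg_ends)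
  then have "y \<notin> S" using e by (auto simp: blks_def)
  moreover have "indep (insert y S)"
    using assms(2) e by (intro indepI) (auto simp: blks_def maxind_def dest: indepD)
  ultimately show False
    using maxind_card_le[OF assms(2), of "insert y S"] assms maxind_finite[OF assms(1,2)]
    by (auto simp: maxind_def)
qed

lemma card_blks:
  assumes "finite Y" "maxind Y S"
  shows "card (blks S) = 2 * card S"
proof -
  have "card (blks S) = (\<Sum>x\<in>S. card (ends x))"
    unfolding blks_def using assms maxind_finite[OF assms]
    by (intro card_UN_disjoint) (auto simp: maxind_def dest: indepD)
  also have "\<dots> = (\<Sum>x\<in>S. 2)"
    by (intro sum.cong refl) (use maxind_deg[OF assms(2)] in \<open>simp add: deg_ends\<close>)
  finally show ?thesis by simp
qed

lemma UN_nb_maxind: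
  assumes "maxind Y S"
  shows "(\<Union>x\<in>S. nb x) = \<Union>(blks S)"
proof -
  have "nb x = \<Union>(ends x)" if "x \<in> S" for x
  proof -
    have "ends x \<noteq> {}" using maxind_deg[OF assms that] by (auto simp: deg_ends)
    then show ?thesis by (auto simp: nb_def ends_def)
  qed
  then show ?thesis by (auto simp: blks_def)
qed

lemma deg3_outside:
  assumes "finite Y" "maxind Y S" "\<And>v. v \<in> Y \<Longrightarrow> 2 \<le> deg v" "v \<in> Y" "v \<notin> \<Union>(blks S)"
  shows "3 \<le> deg v"
proof (rule ccontr)
  assume "\<not> 3 \<le> deg v"
  then have "v \<in> D2 Y" using assms(3)[OF assms(4)] assms(4) by (simp add: D2_def)
  then show False using maxind_hit[OF assms(1,2)] assms(5) by (auto simp: ends_def)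
qed

text \<open>The matched block B' is traded for C. This allows two maximum matchings to be compared,
  in their inner edges as well as in the regions outside their blocks.\<close>

lemma swap:
  assumes Y: "finite Y" and S: "maxind Y S" and x: "x \<in> S" "ends x = {B, B'}" "B \<noteq> B'"
    and y: "y \<in> D2 Y" "ends y = {B, C}" "C \<notin> blks S"
  shows "maxind Y (insert y (S - {x}))" and "blks (insert y (S - {x})) = insert C (blks S - {B'})"
proof -
  let ?S = "insert y (S - {x})"
  have ind: "indep S" and sub: "S \<subseteq> D2 Y" using S by (auto simp: maxind_def)
  have far: "B \<notin> ends z" "B' \<notin> ends z" "C \<notin> ends z" if "z \<in> S" "z \<noteq> x" for z
    using indepD[OF ind that(1) x(1)] that x(2) y(3) by (auto simp: blks_def)
  have "y \<notin> S" using y(2,3) by (auto simp: blks_def)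
  then have c: "card ?S = card S"
    using maxind_finite[OF Y S] card.remove[of S x] x(1) by simp
  have "indep ({y} \<union> (S - {x}))"
    by (rule indep_exchange[OF ind]) (use far y(2) in auto)
  then have "indep ?S" by simp
  moreover have "?S \<subseteq> D2 Y" using sub y(1) by blast
  ultimately show "maxind Y ?S"
    using maxind_card_le[OF S] c unfolding maxind_def by simp
  show "blks ?S = insert C (blks S - {B'})"
    using far x y(2,3) by (auto simp: blks_def)
qed

text \<open>Otherwise C - B - B' - C' is an augmenting path, and replacing x by y and y' enlarges
  the matching.\<close>

lemma augment2:
  assumes Y: "finite Y" and S: "maxind Y S" and x: "x \<in> S" "ends x = {B, B'}" "B \<noteq> B'"
    and y: "y \<in> D2 Y" "ends y = {B, C}" "C \<notin> blks S"
    and y': "y' \<in> D2 Y" "ends y' = {B', C'}" "C' \<notin> blks S"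
  shows "C = C'"
proof (rule ccontr)
  assume ne: "C \<noteq> C'"
  let ?I = "{y, y'} \<union> (S - {x})"
  have ind: "indep S" and sub: "S \<subseteq> D2 Y" using S by (auto simp: maxind_def)
  have far: "B \<notin> ends z" "B' \<notin> ends z" "C \<notin> ends z" "C' \<notin> ends z" if "z \<in> S" "z \<noteq> x" for z
    using indepD[OF ind that(1) x(1)] that x(2) y(3) y'(3) by (auto simp: blks_def)
  have V: "B \<in> blks S" "B' \<in> blks S" using x by (auto simp: blks_def)
  have "y \<noteq> y'" using y(2) y'(2,3) ne x(3) V by auto
  have "y \<notin> S" "y' \<notin> S" using y(2,3) y'(2,3) by (auto simp: blks_def)
  then have "card ?I = Suc (card S)"
    using maxind_finite[OF Y S] card.remove[of S x] x(1) \<open>y \<noteq> y'\<close> by simp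
  moreover have "ends y \<inter> ends y' = {}" using y y' ne x(3) V by auto
  then have "indep ?I"
    by (intro indep_exchange[OF ind]) (use far y(2) y'(2) in auto)
  ultimately show False
    using maxind_card_le[OF S, of ?I] sub y(1) y'(1) by auto
qed

text \<open>Here the augmenting path would be C - B - B' - D' - D - C', with x and w replaced by y,
  z and u.\<close>

lemma augment3:
  assumes Y: "finite Y" and S: "maxind Y S"
    and x: "x \<in> S" "ends x = {B, B'}" "B \<noteq> B'" and w: "w \<in> S" "ends w = {D, D'}" "D \<noteq> D'" and "x \<noteq> w"
    and y: "y \<in> D2 Y" "ends y = {B, C}" "C \<notin> blks S"
    and u: "u \<in> D2 Y" "ends u = {D, C'}" "C' \<notin> blks S"
    and z: "z \<in> D2 Y" "ends z = {B', D'}"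
  shows "C = C'"
proof (rule ccontr)
  assume ne: "C \<noteq> C'"
  let ?I = "{y, z, u} \<union> (S - {x, w})"
  have ind: "indep S" and sub: "S \<subseteq> D2 Y" using S by (auto simp: maxind_def)
  have far: "B \<notin> ends v" "B' \<notin> ends v" "C \<notin> ends v" "D \<notin> ends v" "D' \<notin> ends v" "C' \<notin> ends v"
    if "v \<in> S" "v \<noteq> x" "v \<noteq> w" for v
    using indepD[OF ind that(1) x(1)] indepD[OF ind that(1) w(1)] that x(2) w(2) y(3) u(3)
    by (auto simp: blks_def)
  have V: "B \<in> blks S" "B' \<in> blks S" "D \<in> blks S" "D' \<in> blks S"
    unfolding blks_def using x(1,2) w(1,2) by blast+
  have d: "B \<noteq> D" "B \<noteq> D'" "B' \<noteq> D" "B' \<noteq> D'"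
    using indepD[OF ind x(1) w(1), of B] indepD[OF ind x(1) w(1), of B'] \<open>x \<noteq> w\<close> x(2) w(2) by blast+
  have "C \<noteq> B'" "C \<noteq> D" "C \<noteq> D'" "C' \<noteq> B" "C' \<noteq> B'" "C' \<noteq> D'" using V y(3) u(3) by blast+
  then have dis: "ends y \<inter> ends z = {}" "ends y \<inter> ends u = {}" "ends z \<inter> ends u = {}"
    unfolding y(2) z(2) u(2) using ne x(3) w(3) d by simp_all
  then have d3: "y \<noteq> z" "y \<noteq> u" "z \<noteq> u" using y(2) z(2) by blast+
  have m: "C \<in> ends y" "C' \<in> ends u" "B' \<in> ends z" "D' \<in> ends z" "B' \<in> ends x" "D' \<in> ends w"
    using y(2) u(2) z(2) x(2) w(2) by simp_all
  then have "y \<notin> S" "u \<notin> S" using y(3) u(3) unfolding blks_def by blast+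
  moreover have "z \<notin> S"
  proof
    assume "z \<in> S"
    then show False
      using indepD[OF ind x(1), of z B'] indepD[OF ind w(1), of z D'] m \<open>x \<noteq> w\<close> by simp
  qed
  moreover have "card (S - {x, w}) + 2 = card S"
    using x(1) w(1) \<open>x \<noteq> w\<close> maxind_finite[OF Y S] card_mono[of S "{x, w}"] by (simp add: card_Diff_subset)
  ultimately have "card ?I = Suc (card S)"
    using maxind_finite[OF Y S] d3 by simp
  moreover have "indep ?I"
  proof (rule indep_exchange[OF ind])
    fix p q assume p: "p \<in> {y, z, u}"
    show "ends p \<inter> ends q = {}" if "q \<in> S - {x, w}"
      using far[of q] that p y(2) u(2) z(2) by (elim insertE) simp_all
    show "ends p \<inter> ends q = {}" if "q \<in> {y, z, u}" "p \<noteq> q"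
      using dis that p by (elim insertE) (simp_all add: Int_commute)
  qed
  ultimately show False
    using maxind_card_le[OF S, of ?I] sub y(1) u(1) z(1) by auto
qed

lemma ex_best_maxind:
  assumes "finite Y"
  obtains S where "maxind Y S"
    and "\<And>S'. maxind Y S' \<Longrightarrow> card (inn Y (blks S')) \<le> card (inn Y (blks S))"
proof -
  have fD: "finite (D2 Y)" using assms by (simp add: D2_def)
  have "\<exists>S. (S \<subseteq> D2 Y \<and> indep S) \<and> (\<forall>I. I \<subseteq> D2 Y \<and> indep I \<longrightarrow> card I \<le> card S)"
  proof (rule ex_has_greatest_nat[of _ "{}" _ "Suc (card (D2 Y))"])
    show "{} \<subseteq> D2 Y \<and> indep {}" by (simp add: indep_def)
    show "\<forall>I. I \<subseteq> D2 Y \<and> indep I \<longrightarrow> card I < Suc (card (D2 Y))"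
      using fD by (simp add: card_mono less_Suc_eq_le)
  qed
  then obtain S0 where "maxind Y S0" by (auto simp: maxind_def)
  then have "\<exists>S. maxind Y S \<and> (\<forall>S'. maxind Y S' \<longrightarrow> card (inn Y (blks S')) \<le> card (inn Y (blks S)))"
  proof (rule ex_has_greatest_nat[of _ _ _ "Suc (card (D2 Y))"])
    show "\<forall>S'. maxind Y S' \<longrightarrow> card (inn Y (blks S')) < Suc (card (D2 Y))"
      using fD by (auto simp: inn_def less_Suc_eq_le intro: card_mono)
  qed
  then show ?thesis using that by blast
qed

text \<open>Let \<open>U\<close> be the set of edges with exactly one matched end. Augmenting paths force the edges of
  \<open>U\<close> at a matching edge \<open>x\<close> to form a star or, together with \<open>x\<close>, a triangle. Since the matching
  is chosen to span as many edges as possible, every triangle (they are counted by \<open>t\<close>) yields two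
  additional edges inside the matched blocks.\<close>

lemma matching_structure:
  assumes Y: "finite Y"
  obtains S t where "maxind Y S" and "t \<le> card S"
    and "card S + 2 * t \<le> card (inn Y (blks S))"
    and "card (D2 Y - inn Y (blks S)) \<le> 5 * card S + t"
    and "2 * card (inn Y (blks S)) + card (D2 Y - inn Y (blks S)) \<le> 12 * card S"
    and "4 * card S + 2 * t < card (D2 Y - inn Y (blks S)) \<Longrightarrow>
      \<exists>x\<in>S. \<exists>B B'. ends x = {B, B'} \<and> B \<noteq> B' \<and> card ((D2 Y - inn Y (blks S)) \<inter> B) = 5 \<and>
        card (inn Y (blks S) \<inter> B') + card S + 2 * t \<le> card (inn Y (blks S)) + 1"
proof -
  obtain S where S: "maxind Y S"
    and best: "\<And>S'. maxind Y S' \<Longrightarrow> card (inn Y (blks S')) \<le> card (inn Y (blks S))"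
    using ex_best_maxind[OF Y] by blast
  define V where "V = blks S"
  define E where "E = inn Y V"
  define U where "U = D2 Y - E"
  define Ox where "Ox x = {y \<in> U. ends y \<inter> ends x \<noteq> {}}" for x
  have fS: "finite S" using maxind_finite[OF Y S] .
  have ind: "indep S" and SD: "S \<subseteq> D2 Y" using S by (auto simp: maxind_def)
  have fD: "finite (D2 Y)" using Y by (simp add: D2_def)
  have fE: "finite E" and fO: "finite U" using fD by (auto simp: E_def U_def inn_def)
  have fOx: "finite (Ox x)" for x using fO by (simp add: Ox_def)
  have ED: "E \<subseteq> D2 Y" and OD: "U \<subseteq> D2 Y" by (auto simp: E_def U_def inn_def)
  have Sends: "ends x \<subseteq> V" if "x \<in> S" for x using that by (auto simp: V_def blks_def)
  have SE: "S \<subseteq> E" using SD Sends by (auto simp: E_def inn_def)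
  have deg2: "deg v = 2" if "v \<in> D2 Y" for v using that by (simp add: D2_def)
  have VF: "V \<subseteq> F" using blks_sub by (simp add: V_def)
  have pair: "ends v = {B, C}" if "v \<in> D2 Y" "B \<in> ends v" "C \<in> ends v" "B \<noteq> C" for v B C
    using ends_other[OF deg2[OF that(1)] that(2)] that(3,4) by (metis insert_iff singletonD)
  have oends: "\<exists>C. ends y = {B, C} \<and> C \<notin> V \<and> C \<in> F" if "y \<in> U" "B \<in> ends y" "B \<in> V" for y B
  proof -
    have "y \<in> D2 Y" "\<not> ends y \<subseteq> V" using that(1) by (auto simp: U_def E_def inn_def)
    then obtain C where "C \<in> ends y" "C \<notin> V" by blast
    moreover have "ends y = {B, C}"
      using pair[OF \<open>y \<in> D2 Y\<close> that(2) \<open>C \<in> ends y\<close>] that(3) \<open>C \<notin> V\<close> by blast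
    moreover have "C \<in> F" using \<open>C \<in> ends y\<close> by (simp add: ends_iff)
    ultimately show ?thesis using \<open>C \<notin> V\<close> by blast
  qed
  have Oxends: "\<exists>B\<in>ends x. \<exists>C. ends y = {B, C} \<and> C \<notin> V \<and> C \<in> F" if h: "x \<in> S" "y \<in> Ox x" for x y
  proof -
    obtain B where "B \<in> ends y" "B \<in> ends x" "y \<in> U" using h(2) by (auto simp: Ox_def)
    then show ?thesis using oends[of y B] Sends[OF h(1)] by blast
  qed
  have OU: "U = (\<Union>x\<in>S. Ox x)"
  proof
    show "U \<subseteq> (\<Union>x\<in>S. Ox x)"
    proof
      fix y assume y: "y \<in> U"
      then have "ends y \<inter> blks S \<noteq> {}" using maxind_hit[OF Y S] OD by blast
      then show "y \<in> (\<Union>x\<in>S. Ox x)" using y by (auto simp: Ox_def blks_def)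
    qed
  qed (auto simp: Ox_def)
  have Oxdis: "Ox x \<inter> Ox w = {}" if "x \<in> S" "w \<in> S" "x \<noteq> w" for x w
  proof (rule ccontr)
    assume "Ox x \<inter> Ox w \<noteq> {}"
    then obtain y B1 B2 where y: "y \<in> U" "B1 \<in> ends y" "B1 \<in> ends x" "B2 \<in> ends y" "B2 \<in> ends w"
      by (auto simp: Ox_def)
    have "B1 \<noteq> B2" using indepD[OF ind that(1,2)] y that(3) by blast
    then have "ends y = {B1, B2}" using pair[of y B1 B2] y OD by blast
    moreover have "B1 \<in> V" "B2 \<in> V" using Sends y that by blast+
    ultimately show False using y(1) by (auto simp: U_def E_def inn_def)
  qed
  \<comment> \<open>Edges at different ends of x have the same outer block, by
    \<open>augment2\<close>. Since both ends occur, one outer block serves all of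
    \<open>Ox x\<close>.\<close>
  have nonstar: "\<exists>C\<in>F - V. Ox x \<subseteq> C" if x: "x \<in> S" and n: "\<not> (\<exists>B\<in>ends x. Ox x \<subseteq> B)" for x
  proof -
    obtain P Q where PQ: "ends x = {P, Q}" "P \<noteq> Q"
      using deg2[of x] x SD by (auto simp: deg_ends card_2_iff)
    obtain y where y: "y \<in> Ox x" "y \<notin> P" using n PQ by blast
    obtain z where z: "z \<in> Ox x" "z \<notin> Q" using n PQ by blast
    obtain C where C: "ends y = {Q, C}" "C \<notin> V" "C \<in> F"
      using Oxends[OF x y(1)] y(2) PQ by (auto simp: ends_def)
    obtain C' where C': "ends z = {P, C'}" "C' \<notin> V" "C' \<in> F"
      using Oxends[OF x z(1)] z(2) PQ by (auto simp: ends_def)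
    have yz: "y \<in> D2 Y" "z \<in> D2 Y" using y z OD by (auto simp: Ox_def)
    have CC: "C' = C"
      using augment2[OF Y S x PQ yz(2) C'(1) _ yz(1) C(1)] C C' by (simp add: V_def)
    have "w \<in> C" if w: "w \<in> Ox x" for w
    proof -
      have wD: "w \<in> D2 Y" using w OD by (auto simp: Ox_def)
      obtain B D where D: "B \<in> ends x" "ends w = {B, D}" "D \<notin> V" using Oxends[OF x w] by blast
      consider "B = P" | "B = Q" using D(1) PQ by blast
      then have "D = C"
      proof cases
        case 1
        then show ?thesis
          using augment2[OF Y S x PQ wD _ _ yz(1) C(1)] D C by (simp add: V_def)
      next
        case 2
        then show ?thesis
          using augment2[OF Y S x PQ yz(2) C'(1) _ wD] D C' CC by (simp add: V_def)
      qed
      then have "C \<in> ends w" using D(2) by simp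
      then show ?thesis by (simp add: ends_iff)
    qed
    then show ?thesis using C by blast
  qed
  \<comment> \<open>Five edges are what the arguments below need: one end of x carries at least
    three of them, and two such sets do not fit into one block.\<close>
  define T where "T = {x \<in> S. 5 \<le> card (Ox x) \<and> \<not> (\<exists>B\<in>ends x. Ox x \<subseteq> B)}"
  have TS: "T \<subseteq> S" by (auto simp: T_def)
  have fT: "finite T" using TS fS by (rule finite_subset)
  have Oxstar: "card (Ox x) \<le> 5" if "x \<in> S" "B \<in> ends x" "Ox x \<subseteq> B" for x B
  proof -
    have "x \<notin> Ox x" using that SE by (auto simp: Ox_def U_def)
    then have "Ox x \<subseteq> B - {x}" using that by blast
    moreover have "B \<in> F" "x \<in> B" using that(2) by (auto simp: ends_def)
    ultimately have "card (Ox x) \<le> card B - 1"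
      using finB card_mono[of "B - {x}" "Ox x"] by (simp add: card_Diff_singleton)
    then show ?thesis using cardB[OF \<open>B \<in> F\<close>] by simp
  qed
  have OxT: "card (Ox x) \<le> 6" if xT: "x \<in> T" for x
  proof -
    obtain C where "C \<in> F" "Ox x \<subseteq> C" using nonstar[of x] xT by (auto simp: T_def)
    then show ?thesis using card_mono[of C "Ox x"] finB cardB le_trans by blast
  qed
  have OxS: "card (Ox x) \<le> 5" if "x \<in> S - T" for x
    using Oxstar[of x] that by (fastforce simp: T_def)
  \<comment> \<open>Exchanging x for an edge at its fuller end B releases B' and gains at least
    three edges between B and C. As the matching spans the most inner edges, at least three must
    have been lost at B'.\<close>
  have tri: "\<exists>B' B y C. ends x = {B, B'} \<and> B \<noteq> B' \<and> y \<in> D2 Y \<and> ends y = {B, C} \<and> C \<notin> V \<and> C \<in> F \<and>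
      Ox x \<subseteq> C \<and> 3 \<le> card (E \<inter> B')" if xT: "x \<in> T" for x
  proof -
    have x: "x \<in> S" using xT TS by blast
    obtain C where C: "C \<in> F" "C \<notin> V" "Ox x \<subseteq> C" using nonstar[of x] xT by (auto simp: T_def)
    obtain P Q where PQ: "ends x = {P, Q}" "P \<noteq> Q"
      using deg2[of x] x SD by (auto simp: deg_ends card_2_iff)
    have "Ox x = (Ox x \<inter> P) \<union> (Ox x \<inter> Q)"
      using PQ by (auto simp: Ox_def ends_def)
    then have "card (Ox x) \<le> card (Ox x \<inter> P) + card (Ox x \<inter> Q)" by (metis card_Un_le)
    then have "3 \<le> card (Ox x \<inter> P) \<or> 3 \<le> card (Ox x \<inter> Q)" using xT by (auto simp: T_def)
    then obtain B B' where B: "ends x = {B, B'}" "B \<noteq> B'" "3 \<le> card (Ox x \<inter> B)"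
    proof
      assume "3 \<le> card (Ox x \<inter> P)" then show ?thesis using that[of P Q] PQ by blast
    next
      assume "3 \<le> card (Ox x \<inter> Q)" then show ?thesis using that[of Q P] PQ by blast
    qed
    have BV: "B \<in> V" using Sends[OF x] B by blast
    have BF: "B \<in> F" using BV VF by blast
    have leaf: "ends w = {B, C}" if "w \<in> Ox x \<inter> B" for w
    proof (rule pair)
      show "w \<in> D2 Y" using that OD by (auto simp: Ox_def)
      show "B \<in> ends w" "C \<in> ends w" using that C BF by (auto simp: ends_iff)
      show "B \<noteq> C" using BV C by blast
    qed
    have "Ox x \<inter> B \<noteq> {}" using B(3) by force
    then obtain y where y: "y \<in> Ox x \<inter> B" by blast
    have yD: "y \<in> D2 Y" using y OD by (auto simp: Ox_def)
    have sw: "maxind Y (insert y (S - {x}))" "blks (insert y (S - {x})) = insert C (V - {B'})"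
      using swap[OF Y S x B(1,2) yD leaf[OF y]] C by (simp_all add: V_def)
    have "(E - B') \<union> (Ox x \<inter> B) \<subseteq> inn Y (insert C (V - {B'}))"
    proof
      fix w assume "w \<in> (E - B') \<union> (Ox x \<inter> B)"
      then show "w \<in> inn Y (insert C (V - {B'}))"
      proof
        assume "w \<in> E - B'"
        then show ?thesis by (auto simp: E_def inn_def ends_def)
      next
        assume w: "w \<in> Ox x \<inter> B"
        then show ?thesis using leaf[OF w] BV B(2) OD by (auto simp: inn_def Ox_def)
      qed
    qed
    moreover have "finite (inn Y (insert C (V - {B'})))" using fD by (simp add: inn_def)
    ultimately have "card ((E - B') \<union> (Ox x \<inter> B)) \<le> card (inn Y (insert C (V - {B'})))"
      by (intro card_mono)
    also have "\<dots> \<le> card E" using best[OF sw(1)] sw(2) by (simp add: E_def V_def)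
    finally have "card (E - B') + card (Ox x \<inter> B) \<le> card E"
      using fE fOx by (subst (asm) card_Un_disjoint) (auto simp: Ox_def U_def)
    moreover have "card E = card (E \<inter> B') + card (E - B')" using fE by (rule card_Int_Diff)
    ultimately have "3 \<le> card (E \<inter> B')" using B(3) by linarith
    then show ?thesis using B(1,2) yD leaf[OF y] C by blast
  qed
  define G where "G x B' \<longleftrightarrow> (\<exists>B y C. ends x = {B, B'} \<and> B \<noteq> B' \<and> y \<in> D2 Y \<and> ends y = {B, C} \<and> C \<notin> V \<and> C \<in> F \<and>
      Ox x \<subseteq> C \<and> 3 \<le> card (E \<inter> B'))" for x B'
  define b where "b x = (SOME B'. G x B')" for x
  have bG': "G x (b x)" if "x \<in> T" for x
    using tri[OF that] unfolding b_def G_def by (rule someI_ex)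
  have bG: thesis
    if "x \<in> T" and
      "\<And>B y C. ends x = {B, b x} \<Longrightarrow> B \<noteq> b x \<Longrightarrow> y \<in> D2 Y \<Longrightarrow> ends y = {B, C} \<Longrightarrow> C \<notin> V \<Longrightarrow>
        C \<in> F \<Longrightarrow> Ox x \<subseteq> C \<Longrightarrow> 3 \<le> card (E \<inter> b x) \<Longrightarrow> thesis" for x thesis
    using bG'[OF that(1)] unfolding G_def by (elim exE conjE) (rule that(2))
  have two: False if "C \<in> F" "x \<in> S" "w \<in> S" "x \<noteq> w" "Ox x \<subseteq> C" "Ox w \<subseteq> C" "5 \<le> card (Ox x)" "5 \<le> card (Ox w)"
    for C x w
  proof -
    have "card (Ox x \<union> Ox w) = card (Ox x) + card (Ox w)"
      using fOx Oxdis[OF that(2-4)] by (intro card_Un_disjoint)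
    moreover have "card (Ox x \<union> Ox w) \<le> card C"
      using that finB by (intro card_mono) auto
    ultimately show False using cardB[OF that(1)] that(7,8) by linarith
  qed
  \<comment> \<open>The inner edge z would complete the augmenting path y, x, z, w, u, whose outer
    blocks differ because only one of them contains \<open>Ox w\<close>.\<close>
  have no_cross: False
    if x: "x \<in> S" "ends x = {B, B'}" "B \<noteq> B'" and w: "w \<in> T" "x \<noteq> w"
      and y: "y \<in> D2 Y" "ends y = {B, C}" "C \<notin> V" "\<not> Ox w \<subseteq> C" and z: "z \<in> E" "z \<in> B'" "z \<in> b w"
    for x B B' w y C z
  proof -
    have wS: "w \<in> S" using w TS by blast
    obtain D u C' where D: "ends w = {D, b w}" "D \<noteq> b w" "u \<in> D2 Y" "ends u = {D, C'}" "C' \<notin> V" "Ox w \<subseteq> C'"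
      by (rule bG[OF w(1)])
    have "B' \<in> ends x" "b w \<in> ends w" using x(2) D(1) by simp_all
    then have "B' \<noteq> b w" "B' \<in> F" "b w \<in> F" using indepD[OF ind x(1) wS] w(2) by (auto simp: ends_iff)
    then have "ends z = {B', b w}"
      using z ED by (intro pair) (auto simp: ends_iff)
    then have "C = C'"
      using augment3[OF Y S x wS D(1,2) w(2) y(1,2) _ D(3,4)] y(3) D(5) z(1) ED by (auto simp: V_def)
    then show False using y(4) D(6) by blast
  qed
  have bdis: "(E \<inter> b x) \<inter> (E \<inter> b w) = {}" if h: "x \<in> T" "w \<in> T" "x \<noteq> w" for x w
  proof (rule ccontr)
    assume "(E \<inter> b x) \<inter> (E \<inter> b w) \<noteq> {}"
    then obtain z where z: "z \<in> E" "z \<in> b x" "z \<in> b w" by blast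
    obtain B y C where B: "ends x = {B, b x}" "B \<noteq> b x" "y \<in> D2 Y" "ends y = {B, C}" "C \<notin> V" "C \<in> F" "Ox x \<subseteq> C"
      by (rule bG[OF h(1)])
    have "\<not> Ox w \<subseteq> C" using two[of C x w] B h TS by (auto simp: T_def)
    then show False using no_cross[OF _ B(1,2) h(2,3) B(3-5) _ z] h TS by blast
  qed
  have bS: "(S - T) \<inter> b x = {}" if "x \<in> T" for x
  proof (rule ccontr)
    assume "(S - T) \<inter> b x \<noteq> {}"
    then obtain v where v: "v \<in> S" "v \<notin> T" "v \<in> b x" by blast
    have bx: "b x \<in> ends x" by (rule bG[OF that]) simp
    then have "b x \<in> ends v" using v(3) by (simp add: ends_iff)
    then have "x = v" using indepD[OF ind _ v(1) bx] that TS by blast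
    then show False using v that by blast
  qed
  have cT: "3 * card T \<le> card (\<Union>x\<in>T. E \<inter> b x)"
  proof -
    have "(\<Sum>x\<in>T. 3) \<le> (\<Sum>x\<in>T. card (E \<inter> b x))"
      by (intro sum_mono) (rule bG)
    also have "\<dots> = card (\<Union>x\<in>T. E \<inter> b x)"
      using fT fE bdis by (intro card_UN_disjoint[symmetric]) auto
    finally show ?thesis by simp
  qed
  have cST: "card (S - T) = card S - card T" "card T \<le> card S"
    using TS fS fT by (simp_all add: card_Diff_subset card_mono)
  \<comment> \<open>Three inner edges for each member of T, and the matching edge itself for each
    other member of S.\<close>
  have c1: "card S + 2 * card T \<le> card E"
  proof -
    have "card (\<Union>x\<in>T. E \<inter> b x) + card (S - T) = card ((\<Union>x\<in>T. E \<inter> b x) \<union> (S - T))"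
      using fT fE fS bS by (intro card_Un_disjoint[symmetric]) auto
    also have "\<dots> \<le> card E" using fE SE by (intro card_mono) auto
    finally show ?thesis using cT cST by linarith
  qed
  have cO: "card U = (\<Sum>x\<in>T. card (Ox x)) + (\<Sum>x\<in>S - T. card (Ox x))"
  proof -
    have "card U = (\<Sum>x\<in>S. card (Ox x))"
      unfolding OU using fS fOx Oxdis by (intro card_UN_disjoint) auto
    also have "\<dots> = (\<Sum>x\<in>T. card (Ox x)) + (\<Sum>x\<in>S - T. card (Ox x))"
      using TS fS by (metis add.commute sum.subset_diff)
    finally show ?thesis .
  qed
  have oT: "(\<Sum>x\<in>T. card (Ox x)) \<le> 6 * card T"
    using sum_bounded_above[of T "\<lambda>x. card (Ox x)" 6] OxT by (simp add: mult.commute)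
  have c2: "card U \<le> 5 * card S + card T"
    using cO oT sum_bounded_above[of "S - T" "\<lambda>x. card (Ox x)" 5] OxS cST by (simp add: mult.commute)
  have c3: "2 * card E + card U \<le> 12 * card S"
  proof -
    have "D2 Y \<subseteq> \<Union>V \<inter> Y"
    proof
      fix v assume v: "v \<in> D2 Y"
      then have "ends v \<inter> V \<noteq> {}" using maxind_hit[OF Y S] by (simp add: V_def)
      then show "v \<in> \<Union>V \<inter> Y" using v by (auto simp: D2_def ends_def)
    qed
    then have "card (D2 Y) \<le> card (\<Union>V \<inter> Y)" using Y by (intro card_mono) auto
    moreover have "card (D2 Y) = card E + card U"
      using ED fE fD by (simp add: U_def card_Diff_subset card_mono)
    moreover have "card V = 2 * card S" using card_blks[OF Y S] by (simp add: V_def)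
    ultimately show ?thesis using card_UN_inn[OF Y VF] by (simp add: E_def)
  qed
  have c4: "\<exists>x\<in>S. \<exists>B B'. ends x = {B, B'} \<and> B \<noteq> B' \<and> card (U \<inter> B) = 5 \<and>
        card (E \<inter> B') + card S + 2 * card T \<le> card E + 1" if big: "4 * card S + 2 * card T < card U"
  proof -
    have "\<exists>x\<in>S - T. card (Ox x) = 5"
    proof (rule ccontr)
      assume "\<not> ?thesis"
      then have "card (Ox x) \<le> 4" if "x \<in> S - T" for x using OxS[OF that] that by force
      then have "(\<Sum>x\<in>S - T. card (Ox x)) \<le> 4 * card (S - T)"
        using sum_bounded_above[of "S - T" "\<lambda>x. card (Ox x)" 4] by (simp add: mult.commute)
      then show False using big cO oT cST by linarith
    qed
    then obtain x where x: "x \<in> S" "x \<notin> T" "card (Ox x) = 5" by blast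
    then obtain B where B: "B \<in> ends x" "Ox x \<subseteq> B" by (auto simp: T_def)
    obtain B' where B': "ends x = {B, B'}" "B \<noteq> B'"
    proof -
      have "deg x = 2" using deg2 x(1) SD by blast
      from ends_other[OF this B(1)] that show ?thesis by metis
    qed
    have BV: "B \<in> V" using Sends[OF x(1)] B by blast
    have OB: "U \<inter> B = Ox x"
      using B BV VF by (auto simp: Ox_def ends_def)
    have EB': "(E \<inter> B') \<inter> (E \<inter> b w) = {}" if w: "w \<in> T" for w
    proof (rule ccontr)
      assume "(E \<inter> B') \<inter> (E \<inter> b w) \<noteq> {}"
      then obtain z where z: "z \<in> E" "z \<in> B'" "z \<in> b w" by blast
      obtain C' where C': "C' \<in> F" "Ox w \<subseteq> C'"
        by (rule bG[OF w])
      have xw: "x \<noteq> w" using x w by blast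
      have w5: "5 \<le> card (Ox w)" "w \<in> S" using w by (auto simp: T_def)
      \<comment> \<open>If every outer block of the star contained \<open>Ox w\<close>, these blocks
        would coincide, since an edge of \<open>Ox w\<close> has only one end outside V. Then one
        block would contain ten points.\<close>
      obtain y C where y: "y \<in> Ox x" "ends y = {B, C}" "C \<notin> V" "\<not> Ox w \<subseteq> C"
      proof -
        have "\<exists>y\<in>Ox x. \<exists>C. ends y = {B, C} \<and> C \<notin> V \<and> \<not> Ox w \<subseteq> C"
        proof (rule ccontr)
          assume n: "\<not> ?thesis"
          have leaf: "\<exists>C. ends y = {B, C} \<and> C \<notin> V \<and> C \<in> F \<and> Ox w \<subseteq> C" if "y \<in> Ox x" for y
          proof -
            have "y \<in> U" "B \<in> ends y" using that B(2) BV VF by (auto simp: Ox_def ends_def)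
            then obtain C where C: "ends y = {B, C}" "C \<notin> V" "C \<in> F" using oends[OF _ _ BV] by metis
            have "Ox w \<subseteq> C"
            proof (rule ccontr)
              assume "\<not> Ox w \<subseteq> C"
              then have "\<exists>y\<in>Ox x. \<exists>C. ends y = {B, C} \<and> C \<notin> V \<and> \<not> Ox w \<subseteq> C"
                by (intro bexI[of _ y] exI[of _ C]) (use C that in simp_all)
              then show False using n by simp
            qed
            then show ?thesis using C by (intro exI[of _ C]) simp
          qed
          have "Ox x \<noteq> {}" using x(3) by force
          then obtain y1 where y1: "y1 \<in> Ox x" by blast
          obtain C1 where C1: "ends y1 = {B, C1}" "C1 \<notin> V" "C1 \<in> F" "Ox w \<subseteq> C1" using leaf[OF y1] by metis
          have "Ox x \<subseteq> C1"
          proof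
            fix y assume y: "y \<in> Ox x"
            obtain C where C: "ends y = {B, C}" "C \<notin> V" "C \<in> F" "Ox w \<subseteq> C" using leaf[OF y] by metis
            have "C = C1"
            proof (rule ccontr)
              assume ne: "C \<noteq> C1"
              have "Ox w \<noteq> {}" using w5 by force
              then obtain v where v: "v \<in> Ox w" by blast
              have "C \<in> ends v" "C1 \<in> ends v" using v C(3,4) C1(3,4) unfolding ends_iff by blast+
              moreover have "v \<in> D2 Y" using v OD by (auto simp: Ox_def)
              ultimately have "ends v = {C, C1}" using pair[of v C C1] ne by simp
              moreover have "ends v \<inter> ends w \<noteq> {}" using v by (simp add: Ox_def)
              ultimately have "{C, C1} \<inter> ends w \<noteq> {}" by simp
              then show False using C(2) C1(2) Sends[OF w5(2)] by blast
            qed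
            then have "C1 \<in> ends y" using C by simp
            then show "y \<in> C1" by (simp add: ends_iff)
          qed
          then show False using two[OF C1(3) x(1) w5(2) xw _ C1(4)] x(3) w5(1) by simp
        qed
        then show ?thesis by (elim bexE exE conjE) (rule that)
      qed
      then show False using no_cross[OF x(1) B' w xw _ y(2-4) z] OD by (auto simp: Ox_def)
    qed
    have xB': "(S - T - {x}) \<inter> B' = {}"
    proof (rule ccontr)
      assume "(S - T - {x}) \<inter> B' \<noteq> {}"
      then obtain v where v: "v \<in> S" "v \<noteq> x" "v \<in> B'" by blast
      have "B' \<in> ends x" using B'(1) by simp
      then show False using indepD[OF ind x(1) v(1)] v by (simp add: ends_iff)
    qed
    \<comment> \<open>The edge x is left out of S - T because E \<inter> B' already contains it;
      this is the source of the + 1.\<close>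
    have "card (\<Union>w\<in>T. E \<inter> b w) + card (S - T - {x}) = card ((\<Union>w\<in>T. E \<inter> b w) \<union> (S - T - {x}))"
      using fT fE fS bS by (intro card_Un_disjoint[symmetric]) auto
    moreover have "card ((\<Union>w\<in>T. E \<inter> b w) \<union> (S - T - {x})) + card (E \<inter> B')
        = card (((\<Union>w\<in>T. E \<inter> b w) \<union> (S - T - {x})) \<union> (E \<inter> B'))"
      using fT fE fS EB' xB' by (intro card_Un_disjoint[symmetric]) auto
    moreover have "card (((\<Union>w\<in>T. E \<inter> b w) \<union> (S - T - {x})) \<union> (E \<inter> B')) \<le> card E"
      using fE SE by (intro card_mono) auto
    moreover have "card (S - T - {x}) + 1 = card (S - T)"
      using x fS card.remove[of "S - T" x] by simp
    ultimately have "card (E \<inter> B') + card S + 2 * card T \<le> card E + 1"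
      using cT cST by linarith
    then show ?thesis using x(1) B' OB x(3) by metis
  qed
  show ?thesis
    by (rule that[OF S, of "card T"])
      (use cST c1 c2 c3 c4 in \<open>simp_all add: E_def U_def V_def\<close>)
qed

section \<open>Extremal stars\<close>

text \<open>Exchanging the block \<open>B'\<close> for \<open>C\<close> turns one tight region into another. Their 14-cliques
  nearly coincide, but a point of \<open>B' - C\<close> has only two blocks left to reach such a clique.\<close>

lemma tight_transfer:
  assumes al: "alpha_le (Z - B') b" "alpha_le (Z - C) b" and b: "b \<le> 4"
    and d3: "\<And>v. v \<in> Z - B' \<Longrightarrow> 3 \<le> deg v" "\<And>v. v \<in> Z - C \<Longrightarrow> 3 \<le> deg v"
    and c: "card (Z - B') = 14 * b" "card (Z - C) = 14 * b"
    and e: "exc (Z - B') \<le> 3" "exc (Z - C) \<le> 3"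
    and p: "p \<in> Z" "p \<in> B'" "B' \<in> F" "deg p \<le> 3" and cB: "card (Z \<inter> B') \<le> 5"
  shows "p \<in> C"
proof (rule ccontr)
  assume "p \<notin> C"
  then have pZ: "p \<in> Z - C" using p by blast
  obtain K where K: "K \<subseteq> Z - C" "p \<in> K" "card K = 14" "clique K"
    using tight_cliques[OF al(2) d3(2) b c(2) e(2) pZ] by blast
  have fK: "finite K" using K(3) by (metis card.infinite zero_neq_numeral)
  have fZ: "finite (Z - C)" using al(2) by (rule alpha_finite)
  have fB: "finite (Z \<inter> B')" using finB[OF p(3)] by simp
  let ?Q = "{v \<in> Z - C. deg v \<noteq> 3}"
  have fQ: "finite ?Q" by (rule finite_subset[OF _ fZ]) auto
  have Q: "card ?Q \<le> 3" using deg_ne3_le_exc[OF fZ d3(2)] e(2) by simp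
  \<comment> \<open>14 > 5 + 3, so K has a point of degree 3 that lies in both tight
    regions.\<close>
  have "\<not> K \<subseteq> (Z \<inter> B') \<union> ?Q"
  proof
    assume "K \<subseteq> (Z \<inter> B') \<union> ?Q"
    then have "card K \<le> card ((Z \<inter> B') \<union> ?Q)" using fB fQ by (intro card_mono) simp_all
    also have "\<dots> \<le> card (Z \<inter> B') + card ?Q" by (rule card_Un_le)
    finally show False using K(3) cB Q by linarith
  qed
  then obtain w where w: "w \<in> K" "w \<notin> (Z \<inter> B') \<union> ?Q" by blast
  have wR: "w \<in> Z - B'" "deg w = 3" using w K(1) by auto
  obtain K2 where K2: "K2 \<subseteq> Z - B'" "w \<in> K2" "card K2 = 14" "clique K2"
    using tight_cliques[OF al(1) d3(1) b c(1) e(1) wR(1)] by blast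
  have fK2: "finite K2" using K2(3) by (metis card.infinite zero_neq_numeral)
  have "card (K \<union> K2) \<le> card (nb w)"
    using clique_sub_nb[OF K(4) w(1)] clique_sub_nb[OF K2(4) K2(2)] by (intro card_mono) auto
  then have "card (K \<union> K2) \<le> 16" using card_nb3[OF wR(2)] by simp
  \<comment> \<open>Two 14-cliques within 16 points share 12, whereas the two blocks of p other than
    B' reach at most 10 points besides p.\<close>
  then have 12: "12 \<le> card (K \<inter> K2)" using card_Un_Int[OF fK fK2] K(3) K2(3) by simp
  let ?A = "ends p - {B'}"
  have "B' \<in> ends p" using p by (simp add: ends_iff)
  then have cA: "card ?A \<le> 2" using p(4) by (simp add: deg_ends card_Diff_singleton)
  have "K \<inter> K2 \<subseteq> (\<Union>B\<in>?A. B - {p})"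
  proof
    fix v assume v: "v \<in> K \<inter> K2"
    then have "v \<noteq> p" "v \<notin> B'" using K2(1) p(2) by auto
    moreover have "v \<in> nb p" using clique_sub_nb[OF K(4,2)] v by blast
    ultimately show "v \<in> (\<Union>B\<in>?A. B - {p})" by (auto simp: nb_def ends_def)
  qed
  then have "card (K \<inter> K2) \<le> card (\<Union>B\<in>?A. B - {p})"
    by (intro card_mono) (auto simp: ends_iff finB)
  also have "\<dots> \<le> (\<Sum>B\<in>?A. card (B - {p}))" by (intro card_UN_le) simp
  also have "\<dots> \<le> (\<Sum>B\<in>?A. 5)"
  proof (intro sum_mono)
    fix B assume "B \<in> ?A"
    then have "B \<in> F" "p \<in> B" by (auto simp: ends_iff)
    then show "card (B - {p}) \<le> 5" using cardB[of B] by (simp add: card_Diff_singleton)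
  qed
  finally show False using 12 cA by simp
qed

lemma exc_sub: "finite Y \<Longrightarrow> Z \<subseteq> Y \<Longrightarrow> exc Y \<le> k \<Longrightarrow> exc Z \<le> k"
  using exc_mono le_trans by blast

lemma outside_maxind:
  assumes "alpha_le Y (card S + b)" "maxind Y S" "\<forall>v\<in>Y. 2 \<le> deg v"
  shows "alpha_le (Y - \<Union>(blks S)) b" and "\<And>v. v \<in> Y - \<Union>(blks S) \<Longrightarrow> 3 \<le> deg v"
proof -
  have "S \<subseteq> Y" "indep S" using assms(2) by (auto simp: maxind_def D2_def)
  then show "alpha_le (Y - \<Union>(blks S)) b"
    using alpha_le_remove(1)[OF assms(1), of S] UN_nb_maxind[OF assms(2)] by simp
  show "3 \<le> deg v" if "v \<in> Y - \<Union>(blks S)" for v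
    using deg3_outside[OF alpha_finite[OF assms(1)] assms(2)] assms(3) that by blast
qed

text \<open>Z is the region that is left over when B' is released. The sets \<open>Z - B'\<close>
  and \<open>Z - C\<close> are the regions outside two maximum matchings, which differ by the
  exchange of x for a leaf y, so both obey the same bounds. The 6 is the capacity of B', missing
  from the count of covered points.\<close>

lemma star_setup:
  assumes al: "alpha_le Y (card S + b)" and S: "maxind Y S" and d2: "\<forall>v\<in>Y. 2 \<le> deg v"
    and x: "x \<in> S" "ends x = {B, B'}" "B \<noteq> B'"
  defines "E \<equiv> inn Y (blks S)" and "Z \<equiv> Y - \<Union>(blks S - {B'})"
  shows "card Y + card E + 6 \<le> card Z + 12 * card S + card (E \<inter> B')"
    and "B \<inter> Z = {}" and "x \<notin> Z" and "alpha_le (Z - B') b" and "\<And>v. v \<in> Z - B' \<Longrightarrow> 3 \<le> deg v"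
    and "\<And>y. y \<in> (D2 Y - E) \<inter> B \<Longrightarrow> \<exists>C. ends y = {B, C} \<and> C \<notin> blks S \<and> C \<in> F \<and>
        alpha_le (Z - C) b \<and> (\<forall>v\<in>Z - C. 3 \<le> deg v)"
proof -
  have Y: "finite Y" using al by (rule alpha_finite)
  have "B \<in> ends x" "B' \<in> ends x" using x(2) by simp_all
  then have BV: "B \<in> blks S" "B' \<in> blks S" "B \<in> F" "B' \<in> F" "x \<in> B"
    using x(1) by (auto simp: blks_def ends_iff)
  then show BZ: "B \<inter> Z = {}" using x(3) by (auto simp: Z_def)
  then show "x \<notin> Z" using BV(5) by blast
  have R: "Y - \<Union>(blks S) = Z - B'" using BV(2) by (auto simp: Z_def)
  show "alpha_le (Z - B') b" "\<And>v. v \<in> Z - B' \<Longrightarrow> 3 \<le> deg v"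
    using outside_maxind[OF al S d2] unfolding R by blast+
  show "card Y + card E + 6 \<le> card Z + 12 * card S + card (E \<inter> B')"
  proof -
    have fE: "finite E" using Y by (simp add: E_def inn_def D2_def)
    have "inn Y (blks S - {B'}) = E - B'"
      using BV(4) by (auto simp: E_def inn_def ends_iff)
    moreover have "card (\<Union>(blks S - {B'}) \<inter> Y) + card (inn Y (blks S - {B'})) \<le> 6 * card (blks S - {B'})"
      using blks_sub[of S] by (intro card_UN_inn[OF Y]) blast
    moreover have "card (blks S - {B'}) + 1 = 2 * card S"
    proof -
      have "finite (blks S)" using blks_sub finF by (rule finite_subset)
      then show ?thesis using card_blks[OF Y S] card.remove[OF _ BV(2)] by simp
    qed
    moreover have "card Y = card (Y \<inter> \<Union>(blks S - {B'})) + card Z"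
      unfolding Z_def using Y by (rule card_Int_Diff)
    moreover have "card E = card (E \<inter> B') + card (E - B')" using fE by (rule card_Int_Diff)
    ultimately show ?thesis by (simp add: Int_commute)
  qed
  fix y assume y: "y \<in> (D2 Y - E) \<inter> B"
  have "B \<in> ends y" "deg y = 2" using y BV(3) by (auto simp: ends_iff D2_def)
  then obtain C where C: "ends y = {B, C}" "B \<noteq> C" by (metis ends_other)
  have "\<not> ends y \<subseteq> blks S" using y by (auto simp: E_def inn_def)
  then have CV: "C \<notin> blks S" using C(1) BV(1) by simp
  have "C \<in> ends y" using C(1) by simp
  then have CF: "C \<in> F" by (simp add: ends_iff)
  have yD: "y \<in> D2 Y" using y by blast
  note sw = swap[OF Y S x yD C(1) CV]
  have R': "Y - \<Union>(blks (insert y (S - {x}))) = Z - C"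
    unfolding sw(2) by (auto simp: Z_def)
  have "y \<notin> S" using y C(1) CV by (auto simp: blks_def)
  then have "card (insert y (S - {x})) = card S"
    using maxind_finite[OF Y S] card.remove[of S x] x(1) by simp
  then have al': "alpha_le Y (card (insert y (S - {x})) + b)" using al by simp
  have "alpha_le (Z - C) b" "\<And>v. v \<in> Z - C \<Longrightarrow> 3 \<le> deg v"
    using outside_maxind[OF al' sw(1) d2] unfolding R' by blast+
  then show "\<exists>C. ends y = {B, C} \<and> C \<notin> blks S \<and> C \<in> F \<and> alpha_le (Z - C) b \<and> (\<forall>v\<in>Z - C. 3 \<le> deg v)"
    using C(1) CV CF by (intro exI[of _ C]) simp
qed

text \<open>With no independent point to spare, Z lies in B' and in the outer block of every leaf.
  As Z has at least four points, an outer block has room for only two of the five leaves. So there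
  are at least three outer blocks, and with B' every point of Z has degree at least 4.\<close>

lemma star_full:
  assumes al: "alpha_le Y (card S)" and S: "maxind Y S" and d2: "\<forall>v\<in>Y. 2 \<le> deg v"
    and x: "x \<in> S" "ends x = {B, B'}" "B \<noteq> B'"
    and o5: "card ((D2 Y - inn Y (blks S)) \<inter> B) = 5"
    and big: "12 * card S + card (inn Y (blks S) \<inter> B') \<le> card Y + card (inn Y (blks S)) + 2"
  shows "4 \<le> exc Y"
proof -
  have Y: "finite Y" using al by (rule alpha_finite)
  have al0: "alpha_le Y (card S + 0)" using al by simp
  define Z where "Z = Y - \<Union>(blks S - {B'})"
  define W where "W = (D2 Y - inn Y (blks S)) \<inter> B"
  note st = star_setup[OF al0 S d2 x, folded Z_def W_def]
  have Z4: "4 \<le> card Z" using st(1) big by linarith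
  have fZ: "finite Z" using Y by (simp add: Z_def)
  have fW: "finite W" using Y by (simp add: W_def D2_def)
  have ZB': "Z \<subseteq> B'" using alpha_le_0[OF st(4)] by blast
  have B'V: "B' \<in> blks S" "B' \<in> F" "B \<in> F" using x by (auto simp: blks_def ends_iff set_eq_iff)
  have "\<exists>C. C \<notin> blks S \<and> C \<in> F \<and> Z \<subseteq> C \<and> y \<in> C" if y: "y \<in> W" for y
  proof -
    obtain C where C: "ends y = {B, C}" "C \<notin> blks S" "C \<in> F" "alpha_le (Z - C) 0" using st(6)[OF y] by metis
    have "C \<in> ends y" using C(1) by simp
    then have "y \<in> C" by (simp add: ends_iff)
    moreover have "Z \<subseteq> C" using alpha_le_0[OF C(4)] by blast
    ultimately show ?thesis using C(2,3) by blast
  qed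
  then obtain c where c: "\<And>y. y \<in> W \<Longrightarrow> c y \<notin> blks S \<and> c y \<in> F \<and> Z \<subseteq> c y \<and> y \<in> c y" by metis
  have c2: "card (C \<inter> W) \<le> 2" if C: "C \<in> c ` W" for C
  proof -
    have CF: "C \<in> F" "Z \<subseteq> C" using c C by auto
    have "card ((C \<inter> W) \<union> Z) \<le> card C" using CF finB by (intro card_mono) auto
    moreover have "card ((C \<inter> W) \<union> Z) = card (C \<inter> W) + card Z"
      using fW fZ st(2) by (intro card_Un_disjoint) (auto simp: W_def)
    ultimately show ?thesis using cardB[OF CF(1)] Z4 by linarith
  qed
  have "5 = card W" using o5 by (simp add: W_def)
  also have "\<dots> \<le> card (\<Union>C\<in>c ` W. C \<inter> W)" using fW c by (intro card_mono) auto
  also have "\<dots> \<le> (\<Sum>C\<in>c ` W. card (C \<inter> W))" using fW by (intro card_UN_le) simp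
  also have "\<dots> \<le> (\<Sum>C\<in>c ` W. 2)" by (intro sum_mono c2)
  finally have c3: "3 \<le> card (c ` W)" by simp
  have "4 \<le> deg p" if p: "p \<in> Z" for p
  proof -
    have "B' \<notin> c ` W" using c B'V by auto
    then have "4 \<le> card (insert B' (c ` W))" using c3 fW by simp
    also have "\<dots> \<le> deg p"
    proof -
      have "c y \<in> ends p" if "y \<in> W" for y using c[OF that] p by (auto simp: ends_iff)
      moreover have "B' \<in> ends p" using p ZB' B'V by (auto simp: ends_iff)
      ultimately show ?thesis unfolding deg_ends by (intro card_mono) auto
    qed
    finally show ?thesis .
  qed
  then have "card Z \<le> exc Z" by (rule exc_ge_card)
  also have "\<dots> \<le> exc Y" using Y by (intro exc_mono) (auto simp: Z_def)
  finally show ?thesis using Z4 by simp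
qed

text \<open>Without excess, \<open>Z - A\<close> holds at most 14 b points for A = B' or an outer
  block A, while Z has at least 14 b + 5. So A takes exactly five points of Z and a single one of B.
  The five leaves thus have distinct outer blocks, and \<open>tight_transfer\<close> puts a point of
  Z \<inter> B' into all six blocks.\<close>

lemma star_tight:
  assumes al: "alpha_le Y (card S + b)" and S: "maxind Y S" and d2: "\<forall>v\<in>Y. 2 \<le> deg v"
    and x: "x \<in> S" "ends x = {B, B'}" "B \<noteq> B'" and b: "b \<le> 4"
    and o5: "card ((D2 Y - inn Y (blks S)) \<inter> B) = 5"
    and big: "12 * card S + 14 * b + card (inn Y (blks S) \<inter> B') \<le> card Y + card (inn Y (blks S)) + 1"
  shows "1 \<le> exc Y"
proof (rule ccontr)
  assume "\<not> 1 \<le> exc Y"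
  then have e0: "exc Y \<le> 0" by simp
  have Y: "finite Y" using al by (rule alpha_finite)
  have deg3: "deg v \<le> 3" if "v \<in> Y" for v
    using e0 that Y unfolding exc_def by simp
  define Z where "Z = Y - \<Union>(blks S - {B'})"
  define W where "W = (D2 Y - inn Y (blks S)) \<inter> B"
  note st = star_setup[OF al S d2 x, folded Z_def W_def]
  have ZY: "Z \<subseteq> Y" by (auto simp: Z_def)
  have fZ: "finite Z" using Y ZY by (rule finite_subset[rotated])
  have fW: "finite W" using Y by (simp add: W_def D2_def)
  have Z5: "14 * b + 5 \<le> card Z" using st(1) big by linarith
  have e: "exc (Z - A) \<le> 0" for A using exc_sub[OF Y _ e0, of "Z - A"] ZY by blast
  have le: "card (Z - A) \<le> 14 * b" if "alpha_le (Z - A) b" "\<And>v. v \<in> Z - A \<Longrightarrow> 3 \<le> deg v" for A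
    using excess_bound[OF that b] e[of A] by fastforce
  have exact: "card (Z - A) = 14 * b \<and> card (Z \<inter> A) \<le> 5 \<and> 5 \<le> card (Z \<inter> A) \<and> A \<inter> B \<subseteq> {v}"
    if A: "A \<in> F" "v \<in> A" "v \<in> B" "alpha_le (Z - A) b" "\<And>u. u \<in> Z - A \<Longrightarrow> 3 \<le> deg u" for A v
  proof -
    have "card (Z - A) \<le> 14 * b" using le A(4,5) by blast
    moreover have cZ: "card Z = card (Z \<inter> A) + card (Z - A)" using fZ by (rule card_Int_Diff)
    moreover have "card ((Z \<inter> A) \<union> (A \<inter> B)) \<le> 6"
      using A(1) finB cardB[OF A(1)] card_mono[of A "(Z \<inter> A) \<union> (A \<inter> B)"] by auto
    moreover have "card ((Z \<inter> A) \<union> (A \<inter> B)) = card (Z \<inter> A) + card (A \<inter> B)"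
      using fZ finB[OF A(1)] st(2) by (intro card_Un_disjoint) auto
    moreover have "A \<inter> B \<noteq> {}" using A by blast
    then have "1 \<le> card (A \<inter> B)" using finB[OF A(1)] by (simp add: Suc_le_eq card_gt_0_iff)
    ultimately have r: "card (Z - A) = 14 * b" "card (Z \<inter> A) \<le> 5" "5 \<le> card (Z \<inter> A)" "card (A \<inter> B) = 1"
      using Z5 by linarith+
    then obtain u where "A \<inter> B = {u}" by (auto simp: card_1_singleton_iff)
    then show ?thesis using r A(2,3) by auto
  qed
  have "B' \<in> ends x" "B \<in> ends x" using x(2) by simp_all
  then have B'F: "B' \<in> F" "x \<in> B'" "x \<in> B" "B' \<in> blks S" using x(1) by (auto simp: ends_iff blks_def)
  have B'x: "card (Z - B') = 14 * b" "card (Z \<inter> B') \<le> 5" "5 \<le> card (Z \<inter> B')"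
    using exact[OF B'F(1-3) st(4,5)] by blast+
  have leaf: "\<exists>C. C \<notin> blks S \<and> C \<in> F \<and> C \<inter> B \<subseteq> {y} \<and> y \<in> C \<and> Z \<inter> B' \<subseteq> C" if y: "y \<in> W" for y
  proof -
    obtain C where C: "ends y = {B, C}" "C \<notin> blks S" "C \<in> F" "alpha_le (Z - C) b" "\<forall>v\<in>Z - C. 3 \<le> deg v"
      using st(6)[OF y] by metis
    have "C \<in> ends y" "B \<in> ends y" using C(1) by simp_all
    then have yC: "y \<in> C" "y \<in> B" by (simp_all add: ends_iff)
    have ex: "card (Z - C) = 14 * b" "C \<inter> B \<subseteq> {y}"
      using exact[OF C(3) yC C(4)] C(5) by blast+
    have "p \<in> C" if p: "p \<in> Z" "p \<in> B'" for p
      using tight_transfer[OF st(4) C(4) b st(5) _ B'x(1) ex(1) _ _ p B'F(1) _ B'x(2)]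
        C(5) e[of B'] e[of C] deg3[of p] p(1) ZY by auto
    then show ?thesis using C(2,3) ex(2) yC by blast
  qed
  then obtain c where c: "\<And>y. y \<in> W \<Longrightarrow>
      c y \<notin> blks S \<and> c y \<in> F \<and> c y \<inter> B \<subseteq> {y} \<and> y \<in> c y \<and> Z \<inter> B' \<subseteq> c y"
    by metis
  have inj: "inj_on c W"
  proof (rule inj_onI)
    fix u v assume uv: "u \<in> W" "v \<in> W" "c u = c v"
    then have "v \<in> c u \<inter> B" using c[of v] by (auto simp: W_def)
    then show "u = v" using c[OF uv(1)] by blast
  qed
  have "Z \<inter> B' \<noteq> {}" using B'x(3) by force
  then obtain p where p: "p \<in> Z" "p \<in> B'" by blast
  have "B' \<notin> c ` W" using c B'F(4) by auto
  then have "card (insert B' (c ` W)) = 6" using fW inj o5 by (simp add: card_image W_def[symmetric])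
  moreover have "card (insert B' (c ` W)) \<le> deg p"
  proof -
    have "c y \<in> ends p" if "y \<in> W" for y using c[OF that] p by (auto simp: ends_iff)
    moreover have "B' \<in> ends p" using p B'F(1) by (simp add: ends_iff)
    ultimately show ?thesis unfolding deg_ends by (intro card_mono) auto
  qed
  ultimately show False using deg3[of p] p ZY by auto
qed

text \<open>For 67 points the count alone leaves room for a star and a tight region of 56 points.\<close>

lemma single_matching:
  assumes al: "alpha_le Y 5" and S: "maxind Y S" "card S = 1" and d2: "\<forall>v\<in>Y. 2 \<le> deg v"
    and n: "67 \<le> card Y" and D9: "card (D2 Y) \<le> 9"
    and D6: "card (inn Y (blks S)) = 1 \<Longrightarrow> card (D2 Y) \<le> 6"
  shows "card (D2 Y) < 3 + exc Y"
proof (rule ccontr)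
  assume "\<not> ?thesis"
  then have big: "3 + exc Y \<le> card (D2 Y)" by simp
  have Y: "finite Y" using al by (rule alpha_finite)
  have fD: "finite (D2 Y)" using Y by (simp add: D2_def)
  have single: "maxind Y {v}" if "v \<in> D2 Y" for v
    using S that by (auto simp: maxind_def)
  have blks1: "blks {v} = ends v" for v by (simp add: blks_def)
  \<comment> \<open>Every single point of degree 2 is a maximum matching here. Its blocks meet at
    most 12 - 1 points of Y, and the excess, at most 6, is too small for more than 56 points in the
    rest; 67 = 11 + 56 makes everything tight.\<close>
  have region: "alpha_le (Y - \<Union>(ends v)) 4 \<and> (\<forall>u\<in>Y - \<Union>(ends v). 3 \<le> deg u) \<and>
      card (Y - \<Union>(ends v)) = 56 \<and> inn Y (ends v) = {v}" if v: "v \<in> D2 Y" for v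
  proof -
    have al': "alpha_le Y (card {v} + 4)" using al by simp
    have R: "alpha_le (Y - \<Union>(ends v)) 4" "\<And>u. u \<in> Y - \<Union>(ends v) \<Longrightarrow> 3 \<le> deg u"
      using outside_maxind[OF al' single[OF v] d2] unfolding blks1 by blast+
    have "exc (Y - \<Union>(ends v)) \<le> exc Y" using Y by (intro exc_mono) auto
    then have le: "card (Y - \<Union>(ends v)) \<le> 56"
      using excess_bound[OF R] big D9 by fastforce
    have "card (ends v) = 2" using v by (simp add: D2_def deg_ends)
    then have "card (\<Union>(ends v) \<inter> Y) + card (inn Y (ends v)) \<le> 12"
      using card_UN_inn[OF Y, of "ends v"] by (auto simp: ends_def)
    moreover have vi: "v \<in> inn Y (ends v)" using v by (simp add: inn_def)
    moreover have fi: "finite (inn Y (ends v))" using fD by (simp add: inn_def)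
    then have "1 \<le> card (inn Y (ends v))" using vi by (metis One_nat_def Suc_leI card_gt_0_iff empty_iff)
    moreover have "card Y = card (Y \<inter> \<Union>(ends v)) + card (Y - \<Union>(ends v))"
      using Y by (rule card_Int_Diff)
    ultimately have c: "card (Y - \<Union>(ends v)) = 56" "card (inn Y (ends v)) = 1"
      using le n by (simp_all add: Int_commute)
    then have "inn Y (ends v) = {v}" using vi by (metis card_1_singletonE singletonD)
    then show ?thesis using R c(1) by blast
  qed
  have "S \<subseteq> D2 Y" using S by (simp add: maxind_def)
  moreover obtain s where "S = {s}" using S(2) by (rule card_1_singletonE)
  ultimately have "card (D2 Y) \<le> 6" using D6 region[of s] by (simp add: blks1)
  then have e3: "exc Y \<le> 3" using big by simp
  have pair: "ends v = {B, C}" if "v \<in> D2 Y" "B \<in> ends v" "C \<in> ends v" "B \<noteq> C" for v B C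
  proof -
    have "deg v = 2" using that(1) by (simp add: D2_def)
    then show ?thesis using ends_other[OF _ that(2)] that(3,4) by (metis insert_iff singletonD)
  qed
  have same: "u = v" if "u \<in> D2 Y" "v \<in> D2 Y" "ends u = ends v" for u v
    using region[OF that(2)] that by (auto simp: inn_def)
  have meet: "ends u \<inter> ends v \<noteq> {}" if "u \<in> D2 Y" "v \<in> D2 Y" "u \<noteq> v" for u v
  proof
    assume "ends u \<inter> ends v = {}"
    then have "indep {u, v}" by (intro indepI) auto
    then show False using maxind_card_le[OF S(1), of "{u, v}"] that S(2) by simp
  qed
  have five: "card ((Y - B) \<inter> B') \<le> 5 \<and> 5 \<le> card ((Y - B) \<inter> B') \<and> Y - B - B' = Y - \<Union>(ends x)
      \<and> B \<in> F \<and> B' \<in> F \<and> card (B \<inter> B') \<le> 1"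
    if x: "x \<in> D2 Y" "ends x = {B, B'}" "B \<noteq> B'" for x B B'
  proof -
    have "B \<in> ends x" "B' \<in> ends x" using x(2) by simp_all
    then have F: "B \<in> F" "B' \<in> F" "x \<in> B" "x \<in> B'" by (simp_all add: ends_iff)
    have R: "Y - B - B' = Y - \<Union>(ends x)" using x(2) by auto
    then have "card (Y - B - B') = 56" using region[OF x(1)] by simp
    moreover have "card Y = card (Y \<inter> B) + card (Y - B)" using Y by (rule card_Int_Diff)
    moreover have "card (Y - B) = card ((Y - B) \<inter> B') + card (Y - B - B')"
      using Y by (intro card_Int_Diff) simp
    moreover have "card (Y \<inter> B) \<le> 6"
      using card_mono[OF finB[OF F(1)], of "Y \<inter> B"] cardB[OF F(1)] by simp
    moreover have "card ((Y - B) \<inter> B') + card (B \<inter> B') \<le> 6"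
    proof -
      have "card ((Y - B) \<inter> B') + card (B \<inter> B') = card (((Y - B) \<inter> B') \<union> (B \<inter> B'))"
        using finB[OF F(2)] by (intro card_Un_disjoint[symmetric]) auto
      also have "\<dots> \<le> card B'" using finB[OF F(2)] by (intro card_mono) auto
      finally show ?thesis using cardB[OF F(2)] by simp
    qed
    moreover have "B \<inter> B' \<noteq> {}" using F by blast
    then have "1 \<le> card (B \<inter> B')" using finB[OF F(1)] by (simp add: Suc_le_eq card_gt_0_iff)
    ultimately show ?thesis using R F n by linarith
  qed
  have transfer: "p \<in> C"
    if x: "x \<in> D2 Y" "ends x = {B, B'}" "B \<noteq> B'" and y: "y \<in> D2 Y" "ends y = {B, C}" "B \<noteq> C"
      and p: "p \<in> Y - B" "p \<in> B'" "deg p \<le> 3" for x y p B B' C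
  proof (rule tight_transfer[of "Y - B" B' 4 C p])
    note rx = region[OF x(1)] five[OF x] and ry = region[OF y(1)] five[OF y]
    show "alpha_le (Y - B - B') 4" "alpha_le (Y - B - C) 4" "card (Y - B - B') = 14 * 4" "card (Y - B - C) = 14 * 4"
      using rx ry by simp_all
    show "3 \<le> deg v" if "v \<in> Y - B - B'" for v using rx that by metis
    show "3 \<le> deg v" if "v \<in> Y - B - C" for v using ry that by metis
    show "exc (Y - B - B') \<le> 3" "exc (Y - B - C) \<le> 3" by (rule exc_sub[OF Y _ e3], blast)+
    show "B' \<in> F" "card ((Y - B) \<inter> B') \<le> 5" using rx by simp_all
  qed (use p in simp_all)
  have "D2 Y \<noteq> {}" using big by force
  then obtain x where x: "x \<in> D2 Y" by blast
  \<comment> \<open>Pairwise meeting edges without repetition form a star or a triangle. A triangle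
    has only three edges, so the excess vanishes and \<open>transfer\<close> moves five points of P
    into C, although P and C share at most one.\<close>
  have star: "\<exists>B\<in>ends x. \<forall>v\<in>D2 Y. B \<in> ends v"
  proof (rule ccontr)
    assume n: "\<not> ?thesis"
    obtain P Q where PQ: "ends x = {P, Q}" "P \<noteq> Q"
      using x by (auto simp: D2_def deg_ends card_2_iff)
    obtain y where y: "y \<in> D2 Y" "P \<notin> ends y" using n PQ(1) by blast
    obtain z where z: "z \<in> D2 Y" "Q \<notin> ends z" using n PQ(1) by blast
    have "ends x \<inter> ends y \<noteq> {}" "ends x \<inter> ends z \<noteq> {}"
      using meet[OF x y(1)] meet[OF x z(1)] y z PQ(1) by auto
    then have Qy: "Q \<in> ends y" and Pz: "P \<in> ends z" using PQ(1) y(2) z(2) by auto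
    have "deg y = 2" "deg z = 2" using y z by (simp_all add: D2_def)
    then obtain C C' where C: "ends y = {Q, C}" "Q \<noteq> C" and C': "ends z = {P, C'}" "P \<noteq> C'"
      using ends_other[OF _ Qy] ends_other[OF _ Pz] by metis
    have "y \<noteq> z" using Qy z(2) by blast
    then have "ends y \<inter> ends z \<noteq> {}" using meet y(1) z(1) by blast
    then have CC: "C' = C" using C C' y(2) z(2) by auto
    have "D2 Y \<subseteq> {x, y, z}"
    proof
      fix w assume w: "w \<in> D2 Y"
      show "w \<in> {x, y, z}"
      proof (rule ccontr)
        assume nw: "w \<notin> {x, y, z}"
        have m: "{P, Q} \<inter> ends w \<noteq> {}" "{Q, C} \<inter> ends w \<noteq> {}" "{P, C} \<inter> ends w \<noteq> {}"
          using meet[OF x w] meet[OF y(1) w] meet[OF z(1) w] nw PQ(1) C(1) C'(1) CC by auto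
        have "P \<noteq> C" using C' CC by blast
        consider "P \<in> ends w" "Q \<in> ends w" | "P \<in> ends w" "C \<in> ends w" | "Q \<in> ends w" "C \<in> ends w"
          using m by blast
        then have "ends w = ends x \<or> ends w = ends z \<or> ends w = ends y"
          using pair[OF w, of P Q] pair[OF w, of P C] pair[OF w, of Q C] PQ C C' CC \<open>P \<noteq> C\<close> by cases simp_all
        then show False using same[OF w] x y(1) z(1) nw by blast
      qed
    qed
    then have "card (D2 Y) \<le> card {x, y, z}" by (intro card_mono) auto
    also have "\<dots> \<le> 3" by (simp add: card_insert_if)
    finally have e0: "exc Y = 0" using big by simp
    have "deg p \<le> 3" if "p \<in> Y" for p using e0 that Y by (simp add: exc_def)
    then have "(Y - Q) \<inter> P \<subseteq> P \<inter> C"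
      using transfer[OF x _ _ y(1) C] PQ by (auto simp: insert_commute)
    then have "card ((Y - Q) \<inter> P) \<le> card (P \<inter> C)"
      using five[OF z(1) C'] finB by (intro card_mono) auto
    moreover have "5 \<le> card ((Y - Q) \<inter> P)"
      using five[OF x, of Q P] PQ by (simp add: insert_commute)
    ultimately show False using five[OF z(1) C'] CC by simp
  qed
  then obtain B where B: "B \<in> ends x" "\<And>v. v \<in> D2 Y \<Longrightarrow> B \<in> ends v" by blast
  have "deg v = 2" if "v \<in> D2 Y" for v using that by (simp add: D2_def)
  then have "\<exists>C. ends v = {B, C} \<and> B \<noteq> C" if "v \<in> D2 Y" for v
    using ends_other[OF _ B(2)] that by metis
  then obtain c where c: "\<And>v. v \<in> D2 Y \<Longrightarrow> ends v = {B, c v} \<and> B \<noteq> c v" by metis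
  have inj: "inj_on c (D2 Y)"
    by (rule inj_onI) (use c same in metis)
  define P where "P = (Y - B) \<inter> c x"
  have P5: "5 \<le> card P" using five[OF x] c[OF x] by (simp add: P_def)
  have BF: "B \<in> F" using B(1) by (simp add: ends_iff)
  have P3: "3 \<le> deg p" if "p \<in> P" for p
  proof (rule ccontr)
    assume "\<not> 3 \<le> deg p"
    then have "p \<in> D2 Y" using that d2 by (force simp: P_def D2_def)
    then have "B \<in> ends p" by (rule B(2))
    then show False using that by (simp add: P_def ends_iff)
  qed
  have fP: "finite P" using Y by (simp add: P_def)
  have "card {v \<in> P. deg v \<noteq> 3} \<le> exc P" using deg_ne3_le_exc[OF fP P3] .
  also have "\<dots> \<le> exc Y" using Y by (intro exc_mono) (auto simp: P_def)
  finally have "card {v \<in> P. deg v \<noteq> 3} < card P" using e3 P5 by linarith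
  then have "{v \<in> P. deg v \<noteq> 3} \<noteq> P" by force
  \<comment> \<open>Excess at most 3 leaves a point of degree 3 among the five of P. It is
    transferred into the outer blocks of all points of \<open>D2 Y\<close>, so there are at most
    three of these.\<close>
  then obtain p where p: "p \<in> P" "deg p = 3" by blast
  have all: "p \<in> c y" if "p \<in> P" "deg p = 3" "y \<in> D2 Y" for p y
    using transfer[OF x _ _ that(3), of B "c x" "c y" p] c[OF x] c[OF that(3)] that(1,2)
    by (auto simp: P_def)
  have ends_p: "c ` D2 Y \<subseteq> ends p"
  proof
    fix A assume "A \<in> c ` D2 Y"
    then obtain y where y: "y \<in> D2 Y" "A = c y" by blast
    then have "A \<in> ends y" using c[OF y(1)] by simp
    then show "A \<in> ends p" using all[OF p y(1)] y(2) by (simp add: ends_iff)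
  qed
  then have "card (D2 Y) \<le> deg p"
    using card_mono[OF finite_ends ends_p] inj by (simp add: card_image deg_ends)
  then have e0: "exc Y = 0" and D3: "card (D2 Y) = 3" using big p(2) by simp_all
  have "c ` D2 Y = ends p"
    using ends_p inj D3 p(2) by (intro card_seteq) (simp_all add: card_image deg_ends)
  then have nbp: "nb p = \<Union>(c ` D2 Y)" using x by (auto simp: nb_def ends_def)
  have deg3: "deg v \<le> 3" if "v \<in> Y" for v using e0 that Y by (simp add: exc_def)
  have Pc: "P \<subseteq> c y" if "y \<in> D2 Y" for y
    using all[OF _ _ that] deg3 P3 by (force simp: P_def)
  \<comment> \<open>The three outer blocks share the five points of P and have at most one more
    each. Deleting this small neighbourhood removes all points of degree 2 and leaves 59 points
    where 56 are allowed.\<close>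
  have "card (\<Union>(c ` D2 Y)) \<le> 8"
  proof -
    have "card (\<Union>(c ` D2 Y)) \<le> card (P \<union> (\<Union>y\<in>D2 Y. c y - P))"
      using fP fD c finB by (intro card_mono) (auto simp: ends_iff set_eq_iff)
    also have "\<dots> \<le> card P + card (\<Union>y\<in>D2 Y. c y - P)" by (rule card_Un_le)
    also have "card (\<Union>y\<in>D2 Y. c y - P) \<le> (\<Sum>y\<in>D2 Y. card (c y - P))" using fD by (rule card_UN_le)
    also have "\<dots> \<le> (\<Sum>y\<in>D2 Y. 1)"
    proof (intro sum_mono)
      fix y assume y: "y \<in> D2 Y"
      have "c y \<in> ends y" using c[OF y] by simp
      then have "c y \<in> F" by (simp add: ends_iff)
      then show "card (c y - P) \<le> 1"
        using Pc[OF y] P5 fP cardB[of "c y"] by (simp add: card_Diff_subset)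
    qed
    also have "card P \<le> 5" using five[OF x] c[OF x] by (simp add: P_def)
    finally show ?thesis using D3 by simp
  qed
  then have "card (nb p) \<le> 8" using nbp by simp
  moreover have "card Y - card (nb p) \<le> card (Y - nb p)" by (intro diff_card_le_card_Diff) simp
  ultimately have "59 \<le> card (Y - nb p)" using n by linarith
  moreover have "alpha_le (Y - nb p) 4"
    using alpha_le_remove1[of Y 4 p] al p(1) by (simp add: P_def)
  moreover have "3 \<le> deg v" if "v \<in> Y - nb p" for v
  proof (rule ccontr)
    assume "\<not> 3 \<le> deg v"
    then have v: "v \<in> D2 Y" using that d2 by (force simp: D2_def)
    then have "c v \<in> ends v" using c[OF v] by simp
    then have "v \<in> nb p" using nbp v by (auto simp: ends_iff)
    then show False using that by blast
  qed
  moreover have "exc (Y - nb p) \<le> 0" by (rule exc_sub[OF Y]) (use e0 in auto)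
  ultimately show False using excess_bound[of "Y - nb p" 4] by fastforce
qed

end

section \<open>The lower bound\<close>

text \<open>With \<open>d = 3 n - 6 j\<close>, the first two conclusions read \<open>d + n \<le> 18 * 5\<close> and
  \<open>5 d + 9 n < 126 * 5 + 6\<close>. Coverings of \<open>m\<close> points by \<open>c\<close> blocks contribute \<open>3 m - 6 c\<close> to \<open>d\<close>, and
  the pairs \<open>(m, c) = (6, 1), (9, 3)\<close> lie on the first line, \<open>(9, 3), (14, 7)\<close> on the second.\<close>

lemma counting_arith:
  fixes n :: nat
  assumes n: "n = m + y" "n \<le> 70" and a: "s0 + s + b = 5"
    and w: "3 * n + X \<le> 6 * j + 2 * m + z + e + u"
    and m: "z \<le> s0" "m + 5 * z \<le> 6 * s0"
    and t: "t \<le> s" "s + 2 * t \<le> e" "u \<le> 5 * s + t" "2 * e + u \<le> 12 * s"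
    and y: "y + e \<le> 12 * s + r" "r \<le> y"
    and r: "b = 0 \<longrightarrow> r = 0" "4 * r \<le> 64 * b + X"
      "b \<le> 4 \<longrightarrow> 14 * b < r \<longrightarrow> r + 7 \<le> X + 14 * b"
      "b \<le> 4 \<longrightarrow> 14 * b + 3 \<le> r \<longrightarrow> r + 16 \<le> X + 16 * b"
    and x: "b = 0 \<longrightarrow> 4 * s + 2 * t < u \<longrightarrow> 11 * s \<le> y + 2 * t + 1 \<longrightarrow> 4 \<le> X"
      "b \<le> 4 \<longrightarrow> 4 * s + 2 * t < u \<longrightarrow> 11 * s + 14 * b \<le> y + 2 * t \<longrightarrow> 1 \<le> X"
      "s0 = 0 \<longrightarrow> s = 1 \<longrightarrow> 67 \<le> y \<longrightarrow> e + u < 3 + X"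
  shows "4 * n \<le> 6 * j + 90" and "24 * n \<le> 30 * j + 635" and "n = 67 \<longrightarrow> 3 * n \<le> 6 * j + 2"
proof -
  \<comment> \<open>Roles of the variables: s0 independent points of degree at most 1, z of them of
    degree 0, delete m points; a matching of size s has e inner edges, u outer edges and t
    triangles; r points lie outside its blocks, with at most b independent ones; X is the
    excess.\<close>
  have u6: "u \<le> 6 * s" and eu: "e + u \<le> 9 * s" using t by linarith+
  have mz: "3 * m + z \<le> 18 * s0" "19 * m + 5 * z \<le> 114 * s0" "2 * m + z \<le> 12 * s0" "m \<le> 6 * s0"
    using m by linarith+
  have euy: "5 * e + 5 * u + 9 * y + 3 * t \<le> 129 * s + 9 * r"
    using t(2,3) y(1) by linarith
  \<comment> \<open>Each unit of s0 + s + b = 5 has the budget 126. The first kind stays 12 below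
    it, and r <= 14 b respects it. Only the matching exceeds it, by 3 per edge, and each triangle
    gives 3 back.\<close>
  have main: "24 * n + 5 * X + 3 * t \<le> 30 * j + 114 * s0 + 129 * s + 9 * r"
    using euy mz(2) w n(1) by linarith
  show "4 * n \<le> 6 * j + 90"
  proof -
    have "e + u + y \<le> 18 * s + r" using u6 y(1) by linarith
    moreover have "r \<le> 18 * b + X" using r(2) by linarith
    ultimately show ?thesis using mz(1) w n(1) a by linarith
  qed
  \<comment> \<open>For r = 14 b + k, the bound with 7 gives 5 X >= 5 k + 35, which is at least 9 k
    + 27 just for k <= 2. From k = 3 on the bound with 16 takes over. If b = 5, then r <= 70 = 14
    b.\<close>
  consider (0) "r \<le> 14 * b" | (1) "b \<le> 4" "14 * b < r" "9 * r + 27 \<le> 126 * b + 5 * X"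
    | (3) "b \<le> 4" "14 * b + 3 \<le> r" "r + 16 \<le> X + 16 * b"
  proof (cases "b \<le> 4")
    case True
    show ?thesis
    proof (cases "r \<le> 14 * b + 2")
      case le: True
      show ?thesis
      proof (cases "r \<le> 14 * b")
        case False
        then have "r + 7 \<le> X + 14 * b" using r(3) True by simp
        then have "9 * r + 27 \<le> 126 * b + 5 * X" using le by linarith
        then show ?thesis using 1 True False by simp
      qed (rule 0)
    next
      case False
      then show ?thesis using 3 True r(4) by simp
    qed
  next
    case False
    then have "b = 5" "s0 = 0" "s = 0" using a by simp_all
    then show ?thesis using 0 n y m by simp
  qed
  note rcases = this
  have s0s: "s0 = 0 \<or> s0 = 1 \<or> s0 = 2 \<or> s0 = 3 \<or> s0 = 4 \<or> s0 = 5"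
    "s = 0 \<or> s = 1 \<or> s = 2 \<or> s = 3 \<or> s = 4 \<or> s = 5" using a by linarith+
  show "n = 67 \<longrightarrow> 3 * n \<le> 6 * j + 2"
  proof (rule impI, rule ccontr)
    assume n67: "n = 67" and "\<not> 3 * n \<le> 6 * j + 2"
    then have X: "3 + X \<le> 2 * m + z + e + u" using w by linarith
    have ny: "67 \<le> 6 * s0 + y" using n67 n(1) mz(4) by linarith
    have ye: "y + 2 * t \<le> 11 * s + r" using y(1) t(2) by linarith
    have T: "618 + 5 * X + 3 * t \<le> 114 * s0 + 129 * s + 9 * r"
      using X n67 n(1) euy mz(2) by linarith
    from rcases show False
    proof cases
      case 0
      have "8 * s0 + 3 * s + 2 * t \<le> 3" using 0 ny ye a by linarith
      then have "s0 = 0" "s = 0 \<or> s = 1" by linarith+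
      then have s0: "s0 = 0" "m = 0" "z = 0" using m by simp_all
      have "s \<noteq> 0" using X s0 eu by linarith
      then have "s = 1" using \<open>s = 0 \<or> s = 1\<close> by simp
      then show False using x(3) s0 n67 n(1) X by simp
    next
      case 1
      then have "15 + 3 * t + 12 * s0 \<le> 3 * s" using T a by linarith
      then have "b = 0" using a by linarith
      then show False using 1 r(1) by simp
    next
      case 3
      have X2: "3 + X \<le> 12 * s0 + 9 * s" using X mz(3) eu by linarith
      have ry: "67 \<le> 6 * s0 + 11 * s + r" using ny ye by linarith
      have b: "b = 5 - s0 - s" using a by simp
      show False using s0s
        by (elim disjE) (use X2 ry T r(2) 3 a in linarith)+
    qed
  qed
  show "24 * n \<le> 30 * j + 635"
  proof (rule ccontr)
    assume "\<not> ?thesis"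
    then have c: "30 * j + 636 \<le> 24 * n" by simp
    from rcases show False
    proof cases
      case 1
      then show False using main a c by linarith
    next
      case 3
      have rX: "9 * r + 58 \<le> 5 * X + 144 * b" using 3 r(2) by linarith
      show False
      proof (cases "b \<le> 3")
        case True
        then show False using rX main a c by linarith
      next
        case False
        then have b4: "b = 4" "s0 + s = 1" using 3(1) a by linarith+
        then have "11 \<le> X" using 3 by linarith
        moreover have "24 * n + 5 * X \<le> 30 * j + 630 + 60 * s0 + 45 * s"
          using w mz(3) eu n(2) by linarith
        ultimately show False using c b4(2) by linarith
      qed
    next
      case 0
      have st: "6 + 5 * X + 3 * t + 12 * s0 \<le> 3 * s" using 0 main a c by linarith
      then have "s0 = 0" using a by linarith
      then have s0: "s0 = 0" "m = 0" "z = 0" "n = y" "b + s = 5" using m n a by simp_all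
      have w': "3 * y + X \<le> 6 * j + e + u" "30 * j + 636 \<le> 24 * y" using w c s0 by simp_all
      \<comment> \<open>A violation needs so many outer edges that a star with five of them exists;
        this activates both exchange bounds.\<close>
      have u: "4 * s + 2 * t < u"
      proof -
        have "636 + 4 * e \<le> 5 * u + 108 * s + 9 * r" using w' y(1) by linarith
        moreover have "9 * r + 126 * s \<le> 630" using 0 s0(5) by linarith
        ultimately have "6 + 22 * s + 8 * t \<le> 5 * u" using t(2) by linarith
        then show ?thesis using t(1) by linarith
      qed
      have "t + 2 \<le> s" "s \<le> 5" using st s0(5) by linarith+
      then have s: "s = 2 \<or> s = 3 \<or> s = 4 \<or> s = 5" by linarith
      have x1: "b \<noteq> 0 \<or> y + 2 * t + 1 < 11 * s \<or> 4 \<le> X" using x(1) u by linarith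
      have x2: "y + 2 * t < 11 * s + 14 * b \<or> 1 \<le> X" using x(2) u s0(5) s by linarith
      have b: "b = 5 - s" using s0(5) by simp
      show False
        using s
      proof (elim disjE)
        assume s2: "s = 2"
        have "636 + 5 * X + 4 * e \<le> 5 * u + 216 + 9 * r" using w' y(1) s2 by linarith
        moreover have "9 * r \<le> 378" using 0 s0(5) s2 by linarith
        ultimately have "5 * X + 3 * t \<le> 0" using t(2,3) s2 by linarith
        then have "X = 0" "t = 0" by simp_all
        then have "y \<le> 63" using x2 s2 b by simp
        moreover have "e + u \<le> 12" using \<open>636 + 5 * X + 4 * e \<le> 5 * u + 216 + 9 * r\<close> \<open>9 * r \<le> 378\<close> t(3) \<open>t = 0\<close> s2
          by linarith
        ultimately show False using w' by linarith
      next
        assume s3: "s = 3"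
        have L: "636 + 5 * X + 4 * e \<le> 5 * u + 324 + 9 * r" using w' y(1) s3 by linarith
        have r9: "9 * r \<le> 252" using 0 s0(5) s3 by linarith
        have "5 * X + 3 * t \<le> 3" using L r9 t(2,3) s3 by linarith
        then have "X = 0" by simp
        then have "y + 2 * t \<le> 60" using x2 s3 b by simp
        moreover have "4 * e \<le> 15 + 5 * t" using L r9 t(3) s3 by linarith
        moreover have "5 * u \<le> 75 + 5 * t" using t(3) s3 by linarith
        ultimately show False using w' by linarith
      next
        assume s4: "s = 4"
        then have b1: "b = 1" using b by simp
        have L: "24 * y + 5 * X + 4 * e \<le> 30 * j + 5 * u + 432 + 9 * r"
          using w'(1) y(1) s4 by linarith
        have r14: "r = 14" using L w'(2) t(2,3) 0 b1 s4 by linarith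
        have ye: "y + e = 62" using w' y(1) t(2,3) r14 s4 by linarith
        have L': "5 * X + 4 * e + 78 \<le> 5 * u" using L w'(2) r14 by linarith
        show False
        proof (cases "1 \<le> X")
          case True
          then have "e = 4" "u = 20" "X = 1" using L' t(2,3) s4 by linarith+
          \<comment> \<open>Real values of j between 151/6 and 126/5 survive; only integrality
            closes the case, as in two further cases below.\<close>
          then have "y = 58" "175 \<le> 6 * j + 24" "30 * j + 636 \<le> 1392" using ye w' by simp_all
          then have "25 < j" "j < 26" by linarith+
          then show False by simp
        next
          case False
          then have "y + 2 * t \<le> 57" using x2 s4 b1 by simp
          then have "5 + 2 * t \<le> e" using ye by linarith
          moreover from this have "t = 0" using L' t(3) s4 by linarith
          ultimately have "e = 5" "u = 20" using L' t(3) s4 by linarith+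
          then have "y = 57" "171 \<le> 6 * j + 25" "30 * j + 636 \<le> 1368" using ye w' by simp_all
          then have "24 < j" "j < 25" by linarith+
          then show False by simp
        qed
      next
        assume s5: "s = 5"
        then have r0: "r = 0" using b 0 by simp
        have L: "636 + 5 * X \<le> 5 * e + 5 * u + 9 * y" using w' by linarith
        have ye: "y + e \<le> 60" using y(1) s5 r0 by linarith
        have "X \<le> 1" using L ye t(2,3) s5 by linarith
        then have "y + 2 * t \<le> 53" using x1 b s5 by simp
        moreover from this have "t = 0" using L ye t(2,3) s5 by linarith
        ultimately have "e = 7" "u = 25" "y = 53" using L ye t(2,3) s5 by linarith+
        then have "159 \<le> 6 * j + 32" "30 * j + 636 \<le> 1272" using w' by simp_all
        then have "21 < j" "j < 22" by linarith+
        then show False by simp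
      qed
    qed
  qed
qed

section \<open>Counting over the whole design\<close>

context blocks
begin

lemma sum_deg_le: "finite X \<Longrightarrow> (\<Sum>v\<in>X. deg v) \<le> 6 * card F"
proof -
  assume X: "finite X"
  have "(\<Sum>v\<in>X. deg v) = (\<Sum>v\<in>X. \<Sum>B\<in>F. if v \<in> B then 1 else 0)"
    unfolding deg_def by (simp only: card_eq_sum sum.inter_filter[OF finF])
  also have "\<dots> = (\<Sum>B\<in>F. \<Sum>v\<in>X. if v \<in> B then 1 else 0)" by (rule sum.swap)
  also have "\<dots> = (\<Sum>B\<in>F. card {v \<in> X. v \<in> B})"
    using X by (simp only: card_eq_sum sum.inter_filter)
  also have "\<dots> \<le> (\<Sum>B\<in>F. 6)"
  proof (intro sum_mono)
    fix B assume B: "B \<in> F"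
    have "card {v \<in> X. v \<in> B} \<le> card B" using finB[OF B] by (intro card_mono) auto
    then show "card {v \<in> X. v \<in> B} \<le> 6" using cardB[OF B] by simp
  qed
  finally show ?thesis by simp
qed

lemma region_bound:
  assumes al: "alpha_le Y a" and d2: "\<forall>v\<in>Y. 2 \<le> deg v"
  obtains s b t e u r where "s + b = a"
    and "(\<Sum>v\<in>Y. deg v) + e + u = 3 * card Y + exc Y"
    and "t \<le> s" "s + 2 * t \<le> e" "u \<le> 5 * s + t" "2 * e + u \<le> 12 * s"
    and "card Y + e \<le> 12 * s + r" "r \<le> card Y"
    and "b = 0 \<longrightarrow> r = 0" "4 * r \<le> 64 * b + exc Y"
    and "b \<le> 4 \<longrightarrow> 14 * b < r \<longrightarrow> r + 7 \<le> exc Y + 14 * b"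
    and "b \<le> 4 \<longrightarrow> 14 * b + 3 \<le> r \<longrightarrow> r + 16 \<le> exc Y + 16 * b"
    and "b = 0 \<longrightarrow> 4 * s + 2 * t < u \<longrightarrow> 11 * s \<le> card Y + 2 * t + 1 \<longrightarrow> 4 \<le> exc Y"
    and "b \<le> 4 \<longrightarrow> 4 * s + 2 * t < u \<longrightarrow> 11 * s + 14 * b \<le> card Y + 2 * t \<longrightarrow> 1 \<le> exc Y"
    and "a = 5 \<longrightarrow> s = 1 \<longrightarrow> 67 \<le> card Y \<longrightarrow> e + u < 3 + exc Y"
proof -
  have Y: "finite Y" using al by (rule alpha_finite)
  obtain S t where S: "maxind Y S" and t: "t \<le> card S"
    and E: "card S + 2 * t \<le> card (inn Y (blks S))"
    and U: "card (D2 Y - inn Y (blks S)) \<le> 5 * card S + t"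
    and EU: "2 * card (inn Y (blks S)) + card (D2 Y - inn Y (blks S)) \<le> 12 * card S"
    and star: "4 * card S + 2 * t < card (D2 Y - inn Y (blks S)) \<Longrightarrow>
      \<exists>x\<in>S. \<exists>B B'. ends x = {B, B'} \<and> B \<noteq> B' \<and> card ((D2 Y - inn Y (blks S)) \<inter> B) = 5 \<and>
        card (inn Y (blks S) \<inter> B') + card S + 2 * t \<le> card (inn Y (blks S)) + 1"
    using matching_structure[OF Y] by metis
  define e where "e = card (inn Y (blks S))"
  define u where "u = card (D2 Y - inn Y (blks S))"
  define s where "s = card S"
  define R where "R = Y - \<Union>(blks S)"
  have Ssub: "S \<subseteq> Y" "indep S" using S by (auto simp: maxind_def D2_def)
  have sa: "s \<le> a" using alpha_le_remove(2)[OF al Ssub] by (simp add: s_def)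
  define b where "b = a - s"
  have sb: "s + b = a" using sa by (simp add: b_def)
  have al': "alpha_le Y (card S + b)" using al sb by (simp add: s_def)
  have R: "alpha_le R b" "\<And>v. v \<in> R \<Longrightarrow> 3 \<le> deg v"
    using outside_maxind[OF al' S d2] unfolding R_def by blast+
  have eR: "exc R \<le> exc Y" using Y by (intro exc_mono) (auto simp: R_def)
  have D2: "card (D2 Y) = e + u"
  proof -
    have "inn Y (blks S) \<subseteq> D2 Y" by (auto simp: inn_def)
    moreover have "finite (D2 Y)" using Y by (simp add: D2_def)
    ultimately show ?thesis
      unfolding e_def u_def by (metis Diff_partition Diff_disjoint card_Un_disjoint finite_Diff finite_subset)
  qed
  have degs: "(\<Sum>v\<in>Y. deg v) + e + u = 3 * card Y + exc Y"
  proof -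
    have "(\<Sum>v\<in>Y. deg v + (if deg v = 2 then 1 else 0)) = (\<Sum>v\<in>Y. 3 + (deg v - 3))"
      by (intro sum.cong refl) (use d2 in force)
    moreover have "(\<Sum>v\<in>Y. if deg v = 2 then 1 else 0) = card (D2 Y)"
      unfolding D2_def using Y by (simp only: card_eq_sum sum.inter_filter)
    ultimately show ?thesis using D2 by (simp add: sum.distrib exc_def)
  qed
  have cov: "card Y + e \<le> 12 * s + card R"
  proof -
    have "card (\<Union>(blks S) \<inter> Y) + e \<le> 6 * card (blks S)"
      unfolding e_def using blks_sub by (intro card_UN_inn[OF Y])
    moreover have "card (blks S) = 2 * s" using card_blks[OF Y S] by (simp add: s_def)
    moreover have "card Y = card (Y \<inter> \<Union>(blks S)) + card R"
      unfolding R_def using Y by (rule card_Int_Diff)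
    ultimately show ?thesis by (simp add: Int_commute)
  qed
  show thesis
  proof (rule that[OF sb degs])
    show "t \<le> s" "s + 2 * t \<le> e" "u \<le> 5 * s + t" "2 * e + u \<le> 12 * s"
      using t E U EU by (simp_all add: s_def e_def u_def)
    show "card Y + e \<le> 12 * s + card R" by (rule cov)
    show "card R \<le> card Y" unfolding R_def using Y by (intro card_mono) auto
    show "b = 0 \<longrightarrow> card R = 0" using R(1) alpha_le_0 by fastforce
    show "4 * card R \<le> 64 * b + exc Y" using greedy_bound[OF R] eR by simp
    show "b \<le> 4 \<longrightarrow> 14 * b < card R \<longrightarrow> card R + 7 \<le> exc Y + 14 * b"
      using excess_bound[OF R] eR by auto
    show "b \<le> 4 \<longrightarrow> 14 * b + 3 \<le> card R \<longrightarrow> card R + 16 \<le> exc Y + 16 * b"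
      using excess_bound[OF R] eR by auto
    show "b = 0 \<longrightarrow> 4 * s + 2 * t < u \<longrightarrow> 11 * s \<le> card Y + 2 * t + 1 \<longrightarrow> 4 \<le> exc Y"
    proof (intro impI)
      assume h: "b = 0" "4 * s + 2 * t < u" "11 * s \<le> card Y + 2 * t + 1"
      then obtain x B B' where x: "x \<in> S" "ends x = {B, B'}" "B \<noteq> B'"
        "card ((D2 Y - inn Y (blks S)) \<inter> B) = 5"
        "card (inn Y (blks S) \<inter> B') + s + 2 * t \<le> e + 1"
        using star by (auto simp: s_def u_def e_def)
      have al0: "alpha_le Y (card S)" using al' h(1) by simp
      show "4 \<le> exc Y"
        by (rule star_full[OF al0 S d2 x(1-4)]) (use x(5) h(3) in \<open>simp add: s_def e_def\<close>)
    qed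
    show "b \<le> 4 \<longrightarrow> 4 * s + 2 * t < u \<longrightarrow> 11 * s + 14 * b \<le> card Y + 2 * t \<longrightarrow> 1 \<le> exc Y"
    proof (intro impI)
      assume h: "b \<le> 4" "4 * s + 2 * t < u" "11 * s + 14 * b \<le> card Y + 2 * t"
      then obtain x B B' where x: "x \<in> S" "ends x = {B, B'}" "B \<noteq> B'"
        "card ((D2 Y - inn Y (blks S)) \<inter> B) = 5"
        "card (inn Y (blks S) \<inter> B') + s + 2 * t \<le> e + 1"
        using star by (auto simp: s_def u_def e_def)
      show "1 \<le> exc Y"
        by (rule star_tight[OF al' S d2 x(1-3) h(1) x(4)]) (use x(5) h(3) in \<open>simp add: s_def e_def\<close>)
    qed
    show "a = 5 \<longrightarrow> s = 1 \<longrightarrow> 67 \<le> card Y \<longrightarrow> e + u < 3 + exc Y"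
    proof (intro impI)
      assume h: "a = 5" "s = 1" "67 \<le> card Y"
      have "card (D2 Y) < 3 + exc Y"
      proof (rule single_matching)
        show "alpha_le Y 5" using al h(1) by simp
        show "card S = 1" using h(2) by (simp add: s_def)
        show "card (D2 Y) \<le> 9" using D2 h(2) U EU t by (simp add: s_def e_def u_def)
        show "card (D2 Y) \<le> 6" if "card (inn Y (blks S)) = 1"
          using D2 that h(2) U E by (simp add: s_def e_def u_def)
      qed (use S d2 h(3) in simp_all)
      then show "e + u < 3 + exc Y" using D2 by simp
    qed
  qed
qed

text \<open>A deleted neighbourhood has at most 6 points, and a single one around a point of degree
  0. The latter are counted by z, since they contribute nothing to the degree sum.\<close>

lemma low_degree_removal:
  assumes al: "alpha_le X a"
  obtains Y s0 z m where "Y \<subseteq> X" "card X = m + card Y" "s0 \<le> a" "alpha_le Y (a - s0)"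
    and "\<forall>v\<in>Y. 2 \<le> deg v" "z \<le> s0" "m + 5 * z \<le> 6 * s0"
    and "m + (\<Sum>v\<in>Y. deg v) \<le> (\<Sum>v\<in>X. deg v) + z"
proof -
  have X: "finite X" using al by (rule alpha_finite)
  define P where "P S \<longleftrightarrow> S \<subseteq> {v \<in> X. deg v \<le> 1} \<and> indep S" for S
  have "\<exists>S. P S \<and> (\<forall>I. P I \<longrightarrow> card I \<le> card S)"
  proof (rule ex_has_greatest_nat[of _ "{}" _ "Suc (card X)"])
    show "P {}" by (simp add: P_def indep_def)
    show "\<forall>I. P I \<longrightarrow> card I < Suc (card X)"
      using X by (auto simp: P_def less_Suc_eq_le intro!: card_mono)
  qed
  then obtain S where S: "P S" and max: "\<And>I. P I \<Longrightarrow> card I \<le> card S" by blast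
  have SX: "S \<subseteq> X" "indep S" and d1: "\<And>x. x \<in> S \<Longrightarrow> deg x \<le> 1" using S by (auto simp: P_def)
  have fS: "finite S" using SX(1) X by (rule finite_subset)
  define N where "N = (\<Union>x\<in>S. nb x)"
  define Y where "Y = X - N"
  define Z where "Z = {x \<in> S. deg x = 0}"
  have d2: "2 \<le> deg v" if v: "v \<in> Y" for v
  proof (rule ccontr)
    assume "\<not> 2 \<le> deg v"
    then have "P (insert v S)"
      using v S indep_insert[OF SX(2)] by (auto simp: P_def Y_def N_def)
    moreover have "v \<notin> S" using v nb_self by (auto simp: Y_def N_def)
    ultimately show False using max[of "insert v S"] fS by simp
  qed
  have c: "card X = card (X \<inter> N) + card Y" unfolding Y_def using X by (rule card_Int_Diff)
  have "card (X \<inter> N) \<le> card N" using fS by (intro card_mono) (auto simp: N_def)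
  also have "\<dots> \<le> (\<Sum>x\<in>S. card (nb x))" unfolding N_def using fS by (rule card_UN_le)
  finally have m1: "card (X \<inter> N) \<le> (\<Sum>x\<in>S. card (nb x))" .
  have "(\<Sum>x\<in>S. card (nb x) + 5 * (if deg x = 0 then 1 else 0)) \<le> (\<Sum>x\<in>S. 6)"
  proof (intro sum_mono)
    fix x assume "x \<in> S"
    then show "card (nb x) + 5 * (if deg x = 0 then 1 else 0) \<le> 6"
      using card_nb[of x] d1[of x] by (cases "deg x = 0") auto
  qed
  moreover have "(\<Sum>x\<in>S. if deg x = 0 then 1 else 0) = card Z"
    unfolding Z_def using fS by (simp only: card_eq_sum sum.inter_filter)
  ultimately have m2: "card (X \<inter> N) + 5 * card Z \<le> 6 * card S"
    using m1 by (simp add: sum.distrib sum_distrib_left[symmetric])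
  have "(\<Sum>v\<in>X \<inter> N. 1) \<le> (\<Sum>v\<in>X \<inter> N. deg v + (if v \<in> Z then 1 else 0))"
  proof (intro sum_mono)
    fix v assume v: "v \<in> X \<inter> N"
    show "1 \<le> deg v + (if v \<in> Z then 1 else 0)"
    proof (cases "deg v = 0")
      case True
      \<comment> \<open>A deleted point of degree 0 lies in no neighbourhood but its own, so it was
        itself chosen for S.\<close>
      then have "nb v = {v}"
        using card_nb[of v] card_seteq[of "nb v" "{v}"] by simp
      moreover obtain x where "x \<in> S" "v \<in> nb x" using v by (auto simp: N_def)
      ultimately have "v \<in> S" using in_nb_sym[of v x] by simp
      then show ?thesis using True by (simp add: Z_def)
    qed simp
  qed
  moreover have "(\<Sum>v\<in>X \<inter> N. if v \<in> Z then 1 else 0) \<le> card Z"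
  proof -
    have "(\<Sum>v\<in>X \<inter> N. if v \<in> Z then 1 else 0) = card {v \<in> X \<inter> N. v \<in> Z}"
      using X by (simp only: card_eq_sum sum.inter_filter[OF finite_Int[OF disjI1]])
    also have "\<dots> \<le> card Z" using fS by (intro card_mono) (auto simp: Z_def)
    finally show ?thesis .
  qed
  moreover have "(\<Sum>v\<in>X. deg v) = (\<Sum>v\<in>X \<inter> N. deg v) + (\<Sum>v\<in>Y. deg v)"
    unfolding Y_def using X by (rule sum.Int_Diff)
  ultimately have m3: "card (X \<inter> N) + (\<Sum>v\<in>Y. deg v) \<le> (\<Sum>v\<in>X. deg v) + card Z"
    by (simp add: sum.distrib)
  have "alpha_le Y (a - card S)" using alpha_le_remove(1)[OF al SX] by (simp add: Y_def N_def)
  moreover have "card S \<le> a" using alpha_le_remove(2)[OF al SX] .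
  moreover have "card Z \<le> card S" using fS by (intro card_mono) (auto simp: Z_def)
  ultimately show thesis
    using c d2 m2 m3 by (intro that[of Y "card (X \<inter> N)" "card S" "card Z"]) (auto simp: Y_def)
qed

theorem blocks_lower_bound:
  assumes al: "alpha_le X 5" and n: "card X \<le> 70"
  shows "4 * card X \<le> 6 * card F + 90" and "24 * card X \<le> 30 * card F + 635"
    and "card X = 67 \<longrightarrow> 3 * card X \<le> 6 * card F + 2"
proof -
  have X: "finite X" using al by (rule alpha_finite)
  obtain Y s0 z m where Y: "card X = m + card Y" "s0 \<le> 5" "alpha_le Y (5 - s0)"
    "\<forall>v\<in>Y. 2 \<le> deg v" "z \<le> s0" "m + 5 * z \<le> 6 * s0"
    and deg: "m + (\<Sum>v\<in>Y. deg v) \<le> (\<Sum>v\<in>X. deg v) + z"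
    using low_degree_removal[OF al] by metis
  show "4 * card X \<le> 6 * card F + 90" "24 * card X \<le> 30 * card F + 635"
    "card X = 67 \<longrightarrow> 3 * card X \<le> 6 * card F + 2"
  proof -
    obtain s b t e u r where sb: "s + b = 5 - s0"
      and w: "(\<Sum>v\<in>Y. deg v) + e + u = 3 * card Y + exc Y"
      and t: "t \<le> s" "s + 2 * t \<le> e" "u \<le> 5 * s + t" "2 * e + u \<le> 12 * s"
      and y: "card Y + e \<le> 12 * s + r" "r \<le> card Y"
      and r: "b = 0 \<longrightarrow> r = 0" "4 * r \<le> 64 * b + exc Y"
        "b \<le> 4 \<longrightarrow> 14 * b < r \<longrightarrow> r + 7 \<le> exc Y + 14 * b"
        "b \<le> 4 \<longrightarrow> 14 * b + 3 \<le> r \<longrightarrow> r + 16 \<le> exc Y + 16 * b"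
      and x: "b = 0 \<longrightarrow> 4 * s + 2 * t < u \<longrightarrow> 11 * s \<le> card Y + 2 * t + 1 \<longrightarrow> 4 \<le> exc Y"
        "b \<le> 4 \<longrightarrow> 4 * s + 2 * t < u \<longrightarrow> 11 * s + 14 * b \<le> card Y + 2 * t \<longrightarrow> 1 \<le> exc Y"
        "5 - s0 = 5 \<longrightarrow> s = 1 \<longrightarrow> 67 \<le> card Y \<longrightarrow> e + u < 3 + exc Y"
      by (rule region_bound[OF Y(3,4)])
    have a: "s0 + s + b = 5" using sb Y(2) by simp
    \<comment> \<open>The m deleted points have degree sum at least m - z, so their deficit is at
      most 2 m + z.\<close>
    have w': "3 * card X + exc Y \<le> 6 * card F + 2 * m + z + e + u"
      using w deg sum_deg_le[OF X] Y(1) by linarith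
    have x3: "s0 = 0 \<longrightarrow> s = 1 \<longrightarrow> 67 \<le> card Y \<longrightarrow> e + u < 3 + exc Y" using x(3) by simp
    note res = counting_arith[OF Y(1) n a w' Y(5,6) t y r x(1,2) x3]
    show "4 * card X \<le> 6 * card F + 90" by (rule res(1))
    show "24 * card X \<le> 30 * card F + 635" by (rule res(2))
    show "card X = 67 \<longrightarrow> 3 * card X \<le> 6 * card F + 2" by (rule res(3))
  qed
qed

end

lemma lottery_design_lower:
  assumes "lottery_design n 6 6 2 j X \<B>" "n \<le> 70"
  shows "4 * n \<le> 6 * j + 90" and "24 * n \<le> 30 * j + 635" and "n = 67 \<longrightarrow> 3 * n \<le> 6 * j + 2"
proof -
  have X: "finite X" "card X = n" "card \<B> = j" and sub: "\<And>B. B \<in> \<B> \<Longrightarrow> B \<subseteq> X"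
    and six: "\<And>B. B \<in> \<B> \<Longrightarrow> card B = 6"
    and hit: "\<And>D. D \<subseteq> X \<Longrightarrow> card D = 6 \<Longrightarrow> \<exists>B\<in>\<B>. 2 \<le> card (B \<inter> D)"
    using assms(1) by (auto simp: lottery_design_def hypergraph_def uniform_def)
  have "finite \<B>" using X(1) sub by (intro finite_subset[of \<B> "Pow X"]) auto
  then interpret blocks \<B>
    by unfold_locales (simp_all add: six finite_subset[OF sub X(1)])
  have "alpha_le X 5"
    unfolding alpha_le_def
  proof (intro conjI allI impI)
    show "finite X" by (rule X(1))
    fix I assume I: "I \<subseteq> X" "indep I"
    show "card I \<le> 5"
    proof (rule ccontr)
      assume "\<not> card I \<le> 5"
      then obtain D where D: "D \<subseteq> I" "card D = 6"
        using obtain_subset_with_card_n[of 6 I] by auto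
      then obtain B where B: "B \<in> \<B>" "2 \<le> card (B \<inter> D)" using hit I(1) by blast
      have "\<not> card (B \<inter> D) \<le> Suc 0" using B(2) by simp
      moreover have "finite (B \<inter> D)" using finB[OF B(1)] by simp
      ultimately obtain u v where "u \<in> B \<inter> D" "v \<in> B \<inter> D" "u \<noteq> v"
        using card_le_Suc0_iff_eq by blast
      then show False using I(2) D(1) B(1) unfolding indep_def adj_def by blast
    qed
  qed
  note * = blocks_lower_bound[OF this, unfolded X, OF assms(2)]
  show "4 * n \<le> 6 * j + 90" "24 * n \<le> 30 * j + 635" "n = 67 \<longrightarrow> 3 * n \<le> 6 * j + 2"
    by (rule *)+
qed

section \<open>Constructions\<close>

definition covering :: "nat \<Rightarrow> nat \<Rightarrow> bool" where
  "covering m c \<longleftrightarrow> (\<exists>\<C>. finite \<C> \<and> card \<C> = c \<and> (\<forall>B\<in>\<C>. B \<subseteq> {..<m} \<and> card B = 6) \<and>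
     (\<forall>u<m. \<forall>v<m. \<exists>B\<in>\<C>. u \<in> B \<and> v \<in> B))"

text \<open>Sorted lists make \<open>set\<close> injective on the listed blocks, so that their
  number is the length of the list and all premises can be evaluated.\<close>

lemma coveringI:
  assumes "list_all (\<lambda>B. sorted B \<and> distinct B \<and> length B = 6 \<and> list_all (\<lambda>x. x < m) B) Bs"
    and "distinct Bs \<and> length Bs = c"
    and "list_all (\<lambda>u. list_all (\<lambda>v. list_ex (\<lambda>B. List.member B u \<and> List.member B v) Bs) [0..<m]) [0..<m]"
  shows "covering m c"
  unfolding covering_def
proof (intro exI[of _ "set ` set Bs"] conjI allI impI ballI)
  have "inj_on set (set Bs)"
    using assms(1) by (intro inj_onI sorted_distinct_set_unique) (auto simp: list_all_iff)
  then show "card (set ` set Bs) = c"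
    using assms(2) by (simp add: card_image distinct_card)
  show "B \<subseteq> {..<m}" "card B = 6" if "B \<in> set ` set Bs" for B
    using that assms(1) by (auto simp: list_all_iff distinct_card)
  show "\<exists>B\<in>set ` set Bs. u \<in> B \<and> v \<in> B" if "u < m" "v < m" for u v
    using that assms(3) by (auto simp: list_all_iff list_ex_iff)
qed simp

text \<open>The condition is on all sets with more than k points, because removing the points in a
  new part only bounds the size of the rest from below.\<close>

definition packed :: "nat \<Rightarrow> nat \<Rightarrow> nat \<Rightarrow> bool" where
  "packed n k c \<longleftrightarrow> (\<exists>\<B>. finite \<B> \<and> card \<B> = c \<and> (\<forall>B\<in>\<B>. B \<subseteq> {..<n} \<and> card B = 6) \<and>
     (\<forall>D\<subseteq>{..<n}. k < card D \<longrightarrow> (\<exists>B\<in>\<B>. 2 \<le> card (B \<inter> D))))"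

lemma packed_0: "packed 0 0 0"
  unfolding packed_def by (intro exI[of _ "{}"]) auto

text \<open>Two points of D among the new ones share a translated block; otherwise more than k
  points of D remain among the old ones.\<close>

lemma packed_add:
  assumes "packed n k c" "covering m d" "n' = n + m" "c' = c + d"
  shows "packed n' (Suc k) c'"
proof -
  obtain \<B> where B: "finite \<B>" "card \<B> = c" "\<And>B. B \<in> \<B> \<Longrightarrow> B \<subseteq> {..<n} \<and> card B = 6"
    and hit: "\<And>D. D \<subseteq> {..<n} \<Longrightarrow> k < card D \<Longrightarrow> \<exists>B\<in>\<B>. 2 \<le> card (B \<inter> D)"
    using assms(1) unfolding packed_def by blast
  obtain \<C> where C: "finite \<C>" "card \<C> = d" "\<forall>B\<in>\<C>. B \<subseteq> {..<m} \<and> card B = 6"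
    and pair: "\<forall>u<m. \<forall>v<m. \<exists>B\<in>\<C>. u \<in> B \<and> v \<in> B"
    using assms(2) unfolding covering_def by blast
  let ?f = "\<lambda>x. x + n"
  let ?C = "(`) ?f ` \<C>"
  have inj: "inj_on ?f A" for A by (rule inj_onI) simp
  have "inj_on ((`) ?f) \<C>"
    by (rule inj_onI) (use inj_image_eq_iff[of ?f] inj in blast)
  then have cC: "card ?C = d" using C(2) by (simp add: card_image)
  have sixC: "A \<subseteq> {n..<n + m} \<and> card A = 6" if A: "A \<in> ?C" for A
    using A C(3) by (fastforce simp: card_image[OF inj])
  have "\<B> \<inter> ?C = {}"
  proof (rule ccontr)
    assume "\<B> \<inter> ?C \<noteq> {}"
    then obtain A where A: "A \<in> \<B>" "A \<in> ?C" by blast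
    then have "A \<subseteq> {..<n}" "A \<subseteq> {n..<n + m}" "card A = 6" using B(3) sixC by blast+
    then have "A = {}" by fastforce
    then show False using \<open>card A = 6\<close> by simp
  qed
  then have card: "card (\<B> \<union> ?C) = c'"
    using B(1,2) C(1) cC assms(4) by (simp add: card_Un_disjoint)
  have "\<exists>B\<in>\<B> \<union> ?C. 2 \<le> card (B \<inter> D)" if D: "D \<subseteq> {..<n'}" "Suc k < card D" for D
  proof (cases "card (D \<inter> {n..}) \<le> Suc 0")
    case True
    have fD: "finite D" using D(1) by (rule finite_subset) simp
    have "card D = card (D \<inter> {n..}) + card (D - {n..})" using fD by (rule card_Int_Diff)
    then have "k < card (D - {n..})" using True D(2) by simp
    moreover have "D - {n..} \<subseteq> {..<n}" by auto
    ultimately obtain A where A: "A \<in> \<B>" "2 \<le> card (A \<inter> (D - {n..}))" using hit by blast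
    have "card (A \<inter> (D - {n..})) \<le> card (A \<inter> D)" using fD by (intro card_mono) auto
    then have "2 \<le> card (A \<inter> D)" using A(2) by linarith
    then show ?thesis using A(1) by blast
  next
    case False
    have "finite D" using D(1) by (rule finite_subset) simp
    then have "finite (D \<inter> {n..})" by simp
    then have "\<not> (\<forall>u\<in>D \<inter> {n..}. \<forall>v\<in>D \<inter> {n..}. u = v)"
      using False card_le_Suc0_iff_eq by blast
    then obtain u v where uv: "u \<in> D" "v \<in> D" "n \<le> u" "n \<le> v" "u \<noteq> v"
      by auto
    then have "u - n < m" "v - n < m" using D(1) assms(3) by auto
    then obtain A where A: "A \<in> \<C>" "u - n \<in> A" "v - n \<in> A" using pair by blast
    have "u \<in> ?f ` A" "v \<in> ?f ` A"
      using A(2,3) uv(3,4) by (auto simp: image_iff intro: bexI[of _ "u - n"] bexI[of _ "v - n"])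
    then have "{u, v} \<subseteq> ?f ` A \<inter> D" using uv by blast
    moreover have "finite (?f ` A)" using C(3) A(1) finite_subset[of A "{..<m}"] by auto
    ultimately have "card {u, v} \<le> card (?f ` A \<inter> D)" by (intro card_mono) auto
    then have "2 \<le> card (?f ` A \<inter> D)" using uv(5) by simp
    then show ?thesis using A(1) by blast
  qed
  moreover have "A \<subseteq> {..<n'} \<and> card A = 6" if "A \<in> \<B> \<union> ?C" for A
  proof -
    have "{..<n} \<subseteq> {..<n'}" "{n..<n + m} \<subseteq> {..<n'}" using assms(3) by auto
    then show ?thesis using that B(3)[of A] sixC[of A] by (metis UnE subset_trans)
  qed
  ultimately show ?thesis
    unfolding packed_def using B(1) C(1) card by (intro exI[of _ "\<B> \<union> ?C"]) simp
qed

lemma lottery_number_eqI: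
  assumes "packed n 5 j" "6 \<le> n"
    and "\<And>i (X :: nat set) \<B>. lottery_design n 6 6 2 i X \<B> \<Longrightarrow> j \<le> i"
  shows "lottery_number n 6 6 2 = j"
  unfolding lottery_number_def
proof (rule Least_equality)
  obtain \<B> where "finite \<B>" "card \<B> = j" "\<And>B. B \<in> \<B> \<Longrightarrow> B \<subseteq> {..<n} \<and> card B = 6"
    "\<And>D. D \<subseteq> {..<n} \<Longrightarrow> 5 < card D \<Longrightarrow> \<exists>B\<in>\<B>. 2 \<le> card (B \<inter> D)"
    using assms(1) unfolding packed_def by blast
  then have "lottery_design n 6 6 2 j {..<n} \<B>"
    using assms(2) by (simp add: lottery_design_def hypergraph_def uniform_def)
  then show "\<exists>(X :: nat set) \<B>. lottery_design n 6 6 2 j X \<B>" by blast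
qed (use assms(3) in blast)

section \<open>Explicit coverings and the table of values\<close>

lemma covering_6: "covering 6 1"
  by (rule coveringI[where Bs = "[[0, 1, 2, 3, 4, 5]]"]) code_simp+

text \<open>The pairs {2 i, 2 i + 1} act as single points: three triples cover all pairs of 4
  points. The coverings of 10, 12 and 14 points arise likewise from triples on 5, 6 and 7 points,
  the last from the Fano plane.\<close>

lemma covering_8: "covering 8 3"
  by (rule coveringI[where Bs = "[[0, 1, 2, 3, 4, 5], [0, 1, 2, 3, 6, 7], [0, 1, 4, 5, 6, 7]]"]) code_simp+

text \<open>The edges of a triangle, with every vertex replaced by three points.\<close>

lemma covering_9: "covering 9 3"
  by (rule coveringI[where Bs = "[[0, 1, 2, 3, 4, 5], [0, 1, 2, 6, 7, 8], [3, 4, 5, 6, 7, 8]]"]) code_simp+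

lemma covering_10: "covering 10 4"
  by (rule coveringI[where Bs = "[[0, 1, 2, 3, 4, 5], [2, 3, 4, 5, 6, 7], [2, 3, 4, 5, 8, 9], [0, 1, 6, 7, 8, 9]]"]) code_simp+

lemma covering_12: "covering 12 6"
  by (rule coveringI[where Bs = "[[0, 1, 2, 3, 4, 5], [0, 1, 2, 3, 6, 7], [0, 1, 8, 9, 10, 11], [2, 3, 8, 9, 10, 11], [4, 5, 6, 7, 8, 9], [4, 5, 6, 7, 10, 11]]"]) code_simp+

text \<open>Deleting the point 13 from the covering of 14 points leaves three blocks of five points,
  which are filled up with 2, 0 and 0.\<close>

lemma covering_13: "covering 13 7"
  by (rule coveringI[where Bs = "[[0, 1, 2, 3, 4, 5], [0, 1, 6, 7, 8, 9], [0, 1, 2, 10, 11, 12], [2, 3, 6, 7, 10, 11], [0, 2, 3, 8, 9, 12], [0, 4, 5, 6, 7, 12], [4, 5, 8, 9, 10, 11]]"]) code_simp+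

lemma covering_14: "covering 14 7"
  by (rule coveringI[where Bs = "[[0, 1, 2, 3, 4, 5], [0, 1, 6, 7, 8, 9], [0, 1, 10, 11, 12, 13], [2, 3, 6, 7, 10, 11], [2, 3, 8, 9, 12, 13], [4, 5, 6, 7, 12, 13], [4, 5, 8, 9, 10, 11]]"]) code_simp+


lemma five_coverings:
  assumes "covering m1 c1" "covering m2 c2" "covering m3 c3" "covering m4 c4" "covering m5 c5"
  shows "packed (m1 + m2 + m3 + m4 + m5) 5 (c1 + c2 + c3 + c4 + c5)"
proof -
  have "packed (0 + m1) (Suc 0) (0 + c1)" by (rule packed_add[OF packed_0 assms(1)]) simp_all
  from packed_add[OF packed_add[OF packed_add[OF packed_add[OF this assms(2) refl refl]
        assms(3) refl refl] assms(4) refl refl] assms(5) refl refl]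
  show ?thesis by (simp add: eval_nat_numeral)
qed

text \<open>By the last premise, j - 1 blocks violate one of the lower bounds; these are monotone in
  the number of blocks, so all smaller designs are excluded as well.\<close>

lemma lottery_numberI:
  assumes "covering m1 c1" "covering m2 c2" "covering m3 c3" "covering m4 c4" "covering m5 c5"
    and "n = m1 + m2 + m3 + m4 + m5" "j = c1 + c2 + c3 + c4 + c5" "6 \<le> n" "n \<le> 70"
    and "6 * (j - 1) + 90 < 4 * n \<or> 30 * (j - 1) + 635 < 24 * n \<or> n = 67 \<and> 6 * (j - 1) + 2 < 3 * n"
  shows "lottery_number n 6 6 2 = j"
proof (rule lottery_number_eqI)
  show "packed n 5 j" using five_coverings[OF assms(1-5)] assms(6,7) by simp
  show "j \<le> i" if "lottery_design n 6 6 2 i X \<B>" for i and X :: "nat set" and \<B>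
  proof (rule ccontr)
    assume "\<not> j \<le> i"
    then have "i \<le> j - 1" by simp
    then show False using lottery_design_lower[OF that assms(9)] assms(10) by linarith
  qed
qed (rule assms(8))

theorem mainTheorem1:
  shows "lottery_number 32 6 6 2 = 7 \<and>
    lottery_number 33 6 6 2 = 7 \<and>
    lottery_number 34 6 6 2 = 8 \<and>
    lottery_number 35 6 6 2 = 9 \<and>
    lottery_number 36 6 6 2 = 9 \<and>
    lottery_number 37 6 6 2 = 10 \<and>
    lottery_number 38 6 6 2 = 11 \<and>
    lottery_number 39 6 6 2 = 11 \<and>
    lottery_number 40 6 6 2 = 12 \<and>
    lottery_number 41 6 6 2 = 13 \<and>
    lottery_number 42 6 6 2 = 13 \<and>
    lottery_number 43 6 6 2 = 14 \<and>
    lottery_number 44 6 6 2 = 15 \<and>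
    lottery_number 45 6 6 2 = 15 \<and>
    lottery_number 46 6 6 2 = 16 \<and>
    lottery_number 47 6 6 2 = 17 \<and>
    lottery_number 48 6 6 2 = 18 \<and>
    lottery_number 49 6 6 2 = 19 \<and>
    lottery_number 50 6 6 2 = 19 \<and>
    lottery_number 51 6 6 2 = 20 \<and>
    lottery_number 52 6 6 2 = 21 \<and>
    lottery_number 53 6 6 2 = 22 \<and>
    lottery_number 54 6 6 2 = 23 \<and>
    lottery_number 55 6 6 2 = 23 \<and>
    lottery_number 56 6 6 2 = 24 \<and>
    lottery_number 57 6 6 2 = 25 \<and>
    lottery_number 58 6 6 2 = 26 \<and>
    lottery_number 59 6 6 2 = 27 \<and>
    lottery_number 60 6 6 2 = 27 \<and>
    lottery_number 61 6 6 2 = 28 \<and>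
    lottery_number 62 6 6 2 = 29 \<and>
    lottery_number 63 6 6 2 = 30 \<and>
    lottery_number 64 6 6 2 = 31 \<and>
    lottery_number 65 6 6 2 = 31 \<and>
    lottery_number 66 6 6 2 = 32 \<and>
    lottery_number 67 6 6 2 = 34 \<and>
    lottery_number 68 6 6 2 = 34 \<and>
    lottery_number 69 6 6 2 = 35 \<and>
    lottery_number 70 6 6 2 = 35"
proof (intro conjI)
  show "lottery_number 32 6 6 2 = 7"
    by (rule lottery_numberI[OF covering_6 covering_6 covering_6 covering_6 covering_8]) simp_all
  show "lottery_number 33 6 6 2 = 7"
    by (rule lottery_numberI[OF covering_6 covering_6 covering_6 covering_6 covering_9]) simp_all
  show "lottery_number 34 6 6 2 = 8"
    by (rule lottery_numberI[OF covering_6 covering_6 covering_6 covering_6 covering_10]) simp_all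
  show "lottery_number 35 6 6 2 = 9"
    by (rule lottery_numberI[OF covering_6 covering_6 covering_6 covering_8 covering_9]) simp_all
  show "lottery_number 36 6 6 2 = 9"
    by (rule lottery_numberI[OF covering_6 covering_6 covering_6 covering_9 covering_9]) simp_all
  show "lottery_number 37 6 6 2 = 10"
    by (rule lottery_numberI[OF covering_6 covering_6 covering_6 covering_9 covering_10]) simp_all
  show "lottery_number 38 6 6 2 = 11"
    by (rule lottery_numberI[OF covering_6 covering_6 covering_6 covering_6 covering_14]) simp_all
  show "lottery_number 39 6 6 2 = 11"
    by (rule lottery_numberI[OF covering_6 covering_6 covering_9 covering_9 covering_9]) simp_all
  show "lottery_number 40 6 6 2 = 12"
    by (rule lottery_numberI[OF covering_6 covering_6 covering_9 covering_9 covering_10]) simp_all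
  show "lottery_number 41 6 6 2 = 13"
    by (rule lottery_numberI[OF covering_6 covering_6 covering_6 covering_9 covering_14]) simp_all
  show "lottery_number 42 6 6 2 = 13"
    by (rule lottery_numberI[OF covering_6 covering_9 covering_9 covering_9 covering_9]) simp_all
  show "lottery_number 43 6 6 2 = 14"
    by (rule lottery_numberI[OF covering_6 covering_9 covering_9 covering_9 covering_10]) simp_all
  show "lottery_number 44 6 6 2 = 15"
    by (rule lottery_numberI[OF covering_6 covering_6 covering_9 covering_9 covering_14]) simp_all
  show "lottery_number 45 6 6 2 = 15"
    by (rule lottery_numberI[OF covering_9 covering_9 covering_9 covering_9 covering_9]) simp_all
  show "lottery_number 46 6 6 2 = 16"
    by (rule lottery_numberI[OF covering_9 covering_9 covering_9 covering_9 covering_10]) simp_all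
  show "lottery_number 47 6 6 2 = 17"
    by (rule lottery_numberI[OF covering_6 covering_9 covering_9 covering_9 covering_14]) simp_all
  show "lottery_number 48 6 6 2 = 18"
    by (rule lottery_numberI[OF covering_6 covering_9 covering_9 covering_10 covering_14]) simp_all
  show "lottery_number 49 6 6 2 = 19"
    by (rule lottery_numberI[OF covering_6 covering_6 covering_9 covering_14 covering_14]) simp_all
  show "lottery_number 50 6 6 2 = 19"
    by (rule lottery_numberI[OF covering_9 covering_9 covering_9 covering_9 covering_14]) simp_all
  show "lottery_number 51 6 6 2 = 20"
    by (rule lottery_numberI[OF covering_9 covering_9 covering_9 covering_10 covering_14]) simp_all
  show "lottery_number 52 6 6 2 = 21"
    by (rule lottery_numberI[OF covering_6 covering_9 covering_9 covering_14 covering_14]) simp_all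
  show "lottery_number 53 6 6 2 = 22"
    by (rule lottery_numberI[OF covering_6 covering_9 covering_10 covering_14 covering_14]) simp_all
  show "lottery_number 54 6 6 2 = 23"
    by (rule lottery_numberI[OF covering_6 covering_6 covering_14 covering_14 covering_14]) simp_all
  show "lottery_number 55 6 6 2 = 23"
    by (rule lottery_numberI[OF covering_9 covering_9 covering_9 covering_14 covering_14]) simp_all
  show "lottery_number 56 6 6 2 = 24"
    by (rule lottery_numberI[OF covering_9 covering_9 covering_10 covering_14 covering_14]) simp_all
  show "lottery_number 57 6 6 2 = 25"
    by (rule lottery_numberI[OF covering_6 covering_9 covering_14 covering_14 covering_14]) simp_all
  show "lottery_number 58 6 6 2 = 26"
    by (rule lottery_numberI[OF covering_6 covering_10 covering_14 covering_14 covering_14]) simp_all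
  show "lottery_number 59 6 6 2 = 27"
    by (rule lottery_numberI[OF covering_8 covering_9 covering_14 covering_14 covering_14]) simp_all
  show "lottery_number 60 6 6 2 = 27"
    by (rule lottery_numberI[OF covering_9 covering_9 covering_14 covering_14 covering_14]) simp_all
  show "lottery_number 61 6 6 2 = 28"
    by (rule lottery_numberI[OF covering_9 covering_10 covering_14 covering_14 covering_14]) simp_all
  show "lottery_number 62 6 6 2 = 29"
    by (rule lottery_numberI[OF covering_6 covering_14 covering_14 covering_14 covering_14]) simp_all
  show "lottery_number 63 6 6 2 = 30"
    by (rule lottery_numberI[OF covering_9 covering_12 covering_14 covering_14 covering_14]) simp_all
  show "lottery_number 64 6 6 2 = 31"
    by (rule lottery_numberI[OF covering_8 covering_14 covering_14 covering_14 covering_14]) simp_all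
  show "lottery_number 65 6 6 2 = 31"
    by (rule lottery_numberI[OF covering_9 covering_14 covering_14 covering_14 covering_14]) simp_all
  show "lottery_number 66 6 6 2 = 32"
    by (rule lottery_numberI[OF covering_10 covering_14 covering_14 covering_14 covering_14]) simp_all
  show "lottery_number 67 6 6 2 = 34"
    by (rule lottery_numberI[OF covering_12 covering_13 covering_14 covering_14 covering_14]) simp_all
  show "lottery_number 68 6 6 2 = 34"
    by (rule lottery_numberI[OF covering_12 covering_14 covering_14 covering_14 covering_14]) simp_all
  show "lottery_number 69 6 6 2 = 35"
    by (rule lottery_numberI[OF covering_13 covering_14 covering_14 covering_14 covering_14]) simp_all
  show "lottery_number 70 6 6 2 = 35"
    by (rule lottery_numberI[OF covering_14 covering_14 covering_14 covering_14 covering_14]) simp_all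
qed

end
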